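(* Let $(p_h^1,p_h^2,\phi_h)\in[S_h(\Omega)]^3$ be the finite element solution on the fine grid, let $(p_H^1,p_H^2,\phi_H)\in[S_H(\Omega)]^3$ be the finite element solution on the coarse grid, and let $(p_h^{1,*},p_h^{2,*},\phi_h^* )\in[S_h(\Omega)]^3$ be the semi-decoupled two-grid solution on the fine grid, all as defined in the context. Then there is a constant $C>0$, independent of the mesh sizes $h$ and $H$, such that $$\|\nabla(\phi_h-\phi_h^* )\|_{0,\Omega}\le C\sum_{i=1}^2\|p_h^i-p_H^i\|_{0,\Omega}.$$
   Context: Let $\Omega\subset\mathbb{R}^d$ ($d=2,3$) be a bounded Lipschitz domain, $(\cdot,\cdot)$ the $L^2(\Omega)$ inner product, and $\|\cdot\|_{0,\Omega}$ the $L^2(\Omega)$ norm. Let $q^1=1$, $q^2=-1$, and let $F_1,F_2,F_3\in L^2(\Omega)$ be given. Let $\Gamma_h$ be a quasi-uniform triangulation of $\Omega$ with mesh size $h>0$, and let $S_h(\Omega)=\{v\in H^1(\Omega): v|_{\partial\Omega}=0,\ v|_e \text{ is a polynomial of degree at most } 1 \text{ for every } e\in\Gamma_h\}$. The coarse space $S_H(\Omega)$ is defined in the same way with $h$ replaced by $H$. Standing assumption: the weak steady-state Poisson-Nernst-Planck problem, find $p^1,p^2,\phi\in H_0^1(\Omega)$ with $(\nabla p^i,\nabla v)+(q^ip^i\nabla\phi,\nabla v)=(F_i,v)$ for all $v\in H_0^1(\Omega)$, $i=1,2$, and $(\nabla\phi,\nabla w)=\sum_{i=1}^2 q^i(p^i,w)+(F_3,w)$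 for all $w\in H_0^1(\Omega)$, has a unique solution, and the finite element problems below have unique solutions. Finite element solution on the fine grid: $(p_h^1,p_h^2,\phi_h)\in[S_h(\Omega)]^3$ satisfies $$(\nabla p_h^i,\nabla v_h)+(q^ip_h^i\nabla\phi_h,\nabla v_h)=(F_i,v_h)\quad\forall v_h\in S_h(\Omega),\ i=1,2,$$ $$(\nabla\phi_h,\nabla w_h)=\sum_{i=1}^2q^i(p_h^i,w_h)+(F_3,w_h)\quad\forall w_h\in S_h(\Omega).$$ Finite element solution on the coarse grid: $(p_H^1,p_H^2,\phi_H)\in[S_H(\Omega)]^3$ satisfies the same system with $h$ replaced by $H$ throughout. Semi-decoupled two-grid solution: first $\phi_h^*\in S_h(\Omega)$ is determined by $$(\nabla\phi_h^*,\nabla w_h)=\sum_{i=1}^2q^i(p_H^i,w_h)+(F_3,w_h)\quad\forall w_h\in S_h(\Omega),$$ and then $(p_h^{1,*},p_h^{2,*})\in[S_h(\Omega)]^2$ by $$(\nabla p_h^{i,*},\nabla v_h)+(q^ip_H^i\nabla\phi_h^*,\nabla v_h)=(F_i,v_h)\quad\forall v_h\in S_h(\Omega),\ i=1,2.$$ *)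

theory Defs
  imports "HOL-Analysis.Analysis"
begin

section \<open>Lipschitz domains\<close>

text \<open>Near each boundary point the domain is the strict epigraph of a Lipschitz function over a
  hyperplane: \<open>n\<close> is the direction of the graph, \<open>y - (y \<bullet> n) *\<^sub>R n\<close> the orthogonal projection
  of \<open>y\<close> to the hyperplane orthogonal to \<open>n\<close>.\<close>

definition lipschitz_boundary :: "'a::euclidean_space set \<Rightarrow> bool" where
  "lipschitz_boundary \<Omega> \<longleftrightarrow>
     (\<forall>x \<in> frontier \<Omega>. \<exists>n r L. \<exists>\<gamma> :: 'a \<Rightarrow> real.
        norm n = 1 \<and> 0 < r \<and> L-lipschitz_on {z. z \<bullet> n = 0} \<gamma> \<and>
        \<Omega> \<inter> ball x r = {y \<in> ball x r. \<gamma> (y - (y \<bullet> n) *\<^sub>R n) < y \<bullet> n})"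

definition bounded_lipschitz_domain :: "'a::euclidean_space set \<Rightarrow> bool" where
  "bounded_lipschitz_domain \<Omega> \<longleftrightarrow>
     open \<Omega> \<and> connected \<Omega> \<and> \<Omega> \<noteq> {} \<and> bounded \<Omega> \<and> lipschitz_boundary \<Omega>"

section \<open>Lebesgue and Sobolev spaces\<close>

text \<open>Elements of these spaces are represented by functions; equality in the spaces is equality
  almost everywhere on \<open>\<Omega>\<close>, and values outside \<open>\<Omega>\<close> are irrelevant.\<close>

definition L2 :: "'a::euclidean_space set \<Rightarrow> ('a \<Rightarrow> 'b::euclidean_space) set" where
  "L2 \<Omega> = {f \<in> borel_measurable (lebesgue_on \<Omega>). integrable (lebesgue_on \<Omega>) (\<lambda>x. (norm (f x))\<^sup>2)}"

definition l2_inner :: "'a::euclidean_space set \<Rightarrow> ('a \<Rightarrow> 'b::euclidean_space) \<Rightarrow> ('a \<Rightarrow> 'b) \<Rightarrow> real" where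
  "l2_inner \<Omega> f g = (LINT x | lebesgue_on \<Omega>. f x \<bullet> g x)"

definition l2_norm :: "'a::euclidean_space set \<Rightarrow> ('a \<Rightarrow> 'b::euclidean_space) \<Rightarrow> real" where
  "l2_norm \<Omega> f = sqrt (LINT x | lebesgue_on \<Omega>. (norm (f x))\<^sup>2)"

text \<open>\<open>Ck k f\<close>: \<open>f\<close> is \<open>k\<close> times continuously differentiable on the whole space.\<close>

primrec Ck :: "nat \<Rightarrow> ('a::euclidean_space \<Rightarrow> real) \<Rightarrow> bool" where
  "Ck 0 f \<longleftrightarrow> continuous_on UNIV f"
| "Ck (Suc k) f \<longleftrightarrow> f differentiable_on UNIV \<and>
     (\<forall>i \<in> Basis. Ck k (\<lambda>x. frechet_derivative f (at x) i))"

definition test_function :: "'a::euclidean_space set \<Rightarrow> ('a \<Rightarrow> real) \<Rightarrow> bool" where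
  "test_function \<Omega> \<phi> \<longleftrightarrow> (\<forall>k. Ck k \<phi>) \<and> (\<exists>K. compact K \<and> K \<subseteq> \<Omega> \<and> (\<forall>x. x \<notin> K \<longrightarrow> \<phi> x = 0))"

definition has_weak_gradient ::
    "'a::euclidean_space set \<Rightarrow> ('a \<Rightarrow> real) \<Rightarrow> ('a \<Rightarrow> 'a) \<Rightarrow> bool" where
  "has_weak_gradient \<Omega> v g \<longleftrightarrow> g \<in> L2 \<Omega> \<and>
     (\<forall>\<phi>. test_function \<Omega> \<phi> \<longrightarrow> (\<forall>i \<in> Basis.
        (LINT x | lebesgue_on \<Omega>. v x * frechet_derivative \<phi> (at x) i) =
        - (LINT x | lebesgue_on \<Omega>. (g x \<bullet> i) * \<phi> x)))"

text \<open>The weak gradient is unique only up to null sets; \<open>wgrad\<close> chooses a representative.\<close>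

definition wgrad :: "'a::euclidean_space set \<Rightarrow> ('a \<Rightarrow> real) \<Rightarrow> 'a \<Rightarrow> 'a" where
  "wgrad \<Omega> v = (SOME g. has_weak_gradient \<Omega> v g)"

definition H1 :: "'a::euclidean_space set \<Rightarrow> ('a \<Rightarrow> real) set" where
  "H1 \<Omega> = {v \<in> L2 \<Omega>. \<exists>g. has_weak_gradient \<Omega> v g}"

text \<open>The closure of the test functions in the \<open>H1\<close> norm.\<close>

definition H10 :: "'a::euclidean_space set \<Rightarrow> ('a \<Rightarrow> real) set" where
  "H10 \<Omega> = {v \<in> H1 \<Omega>. \<exists>u :: nat \<Rightarrow> 'a \<Rightarrow> real. (\<forall>n. test_function \<Omega> (u n)) \<and>
     (\<lambda>n. l2_norm \<Omega> (\<lambda>x. u n x - v x)) \<longlonglongrightarrow> 0 \<and>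
     (\<lambda>n. l2_norm \<Omega> (\<lambda>x. wgrad \<Omega> (u n) x - wgrad \<Omega> v x)) \<longlonglongrightarrow> 0}"

section \<open>Finite element spaces\<close>

definition triangulation_of :: "'a::euclidean_space set \<Rightarrow> 'a set set \<Rightarrow> bool" where
  "triangulation_of \<Omega> T \<longleftrightarrow>
     triangulation T \<and> (\<forall>e \<in> T. int DIM('a) simplex e) \<and> \<Union>T = closure \<Omega>"

definition mesh_size :: "'a::euclidean_space set set \<Rightarrow> real" where
  "mesh_size T = Max (diameter ` T)"

text \<open>A family of triangulations \<open>\<Gamma> h\<close>, indexed by its mesh sizes \<open>h \<in> I\<close>. It is quasi-uniform:
  every element contains a ball of radius \<open>\<kappa> * h\<close>, with \<open>\<kappa>\<close> the same for the whole family.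
  As elements have diameter at most \<open>h\<close>, this comprises shape regularity.\<close>

definition quasi_uniform_family ::
    "'a::euclidean_space set \<Rightarrow> real set \<Rightarrow> (real \<Rightarrow> 'a set set) \<Rightarrow> bool" where
  "quasi_uniform_family \<Omega> I \<Gamma> \<longleftrightarrow>
     (\<forall>h \<in> I. 0 < h \<and> triangulation_of \<Omega> (\<Gamma> h) \<and> mesh_size (\<Gamma> h) = h) \<and>
     (\<exists>\<kappa> > 0. \<forall>h \<in> I. \<forall>e \<in> \<Gamma> h. \<exists>c. ball c (\<kappa> * h) \<subseteq> e)"

text \<open>The elements \<open>e\<close> are closed and cover the closure of \<open>\<Omega>\<close>, so asking \<open>v\<close> to be affine at every
  point of each \<open>e\<close> singles out the representative that is continuous on the closure of \<open>\<Omega>\<close>, and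
  the boundary condition is meant pointwise for it.\<close>

definition fe_space :: "'a::euclidean_space set \<Rightarrow> 'a set set \<Rightarrow> ('a \<Rightarrow> real) set" where
  "fe_space \<Omega> T = {v \<in> H1 \<Omega>. (\<forall>x \<in> frontier \<Omega>. v x = 0) \<and>
     (\<forall>e \<in> T. \<exists>a b. \<forall>x \<in> e. v x = a \<bullet> x + b)}"

section \<open>The Poisson-Nernst-Planck system\<close>

text \<open>Concentrations and right-hand sides are families of functions; only the indices 1, 2 of
  \<open>p\<close> and 1, 2, 3 of \<open>F\<close> matter.\<close>

definition charge :: "nat \<Rightarrow> real" where
  "charge i = (if i = 1 then 1 else -1)"

text \<open>\<open>(\<nabla>\<phi>, \<nabla>w) = \<Sum>\<^sub>i q\<^sup>i (p\<^sup>i, w) + (F\<^sub>3, w)\<close> for all \<open>w \<in> V\<close>\<close>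

definition poisson_eq ::
    "'a::euclidean_space set \<Rightarrow> (nat \<Rightarrow> 'a \<Rightarrow> real) \<Rightarrow> ('a \<Rightarrow> real) set \<Rightarrow>
     (nat \<Rightarrow> 'a \<Rightarrow> real) \<Rightarrow> ('a \<Rightarrow> real) \<Rightarrow> bool" where
  "poisson_eq \<Omega> F V p \<phi> \<longleftrightarrow>
     (\<forall>w \<in> V. l2_inner \<Omega> (wgrad \<Omega> \<phi>) (wgrad \<Omega> w) =
        (\<Sum>i \<in> {1, 2}. charge i * l2_inner \<Omega> (p i) w) + l2_inner \<Omega> (F 3) w)"

text \<open>\<open>(\<nabla>p, \<nabla>v) + (q\<^sup>i r \<nabla>\<phi>, \<nabla>v) = (F\<^sub>i, v)\<close> for all \<open>v \<in> V\<close>; the concentration \<open>r\<close> in the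
  drift term is \<open>p\<close> itself in the coupled system. For general \<open>H1\<close> functions the drift integrand
  need not be integrable, and the Bochner integral would then be \<open>0\<close> by convention, so that its
  existence is part of the equation. For finite element functions it is automatic.\<close>

definition nernst_planck_eq ::
    "'a::euclidean_space set \<Rightarrow> (nat \<Rightarrow> 'a \<Rightarrow> real) \<Rightarrow> ('a \<Rightarrow> real) set \<Rightarrow> nat \<Rightarrow>
     ('a \<Rightarrow> real) \<Rightarrow> ('a \<Rightarrow> real) \<Rightarrow> ('a \<Rightarrow> real) \<Rightarrow> bool" where
  "nernst_planck_eq \<Omega> F V i r p \<phi> \<longleftrightarrow>
     (\<forall>v \<in> V.
        integrable (lebesgue_on \<Omega>) (\<lambda>x. ((charge i * r x) *\<^sub>R wgrad \<Omega> \<phi> x) \<bullet> wgrad \<Omega> v x) \<and>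
        l2_inner \<Omega> (wgrad \<Omega> p) (wgrad \<Omega> v)
          + l2_inner \<Omega> (\<lambda>x. (charge i * r x) *\<^sub>R wgrad \<Omega> \<phi> x) (wgrad \<Omega> v)
        = l2_inner \<Omega> (F i) v)"

text \<open>The coupled system with trial and test space \<open>V\<close>: the weak problem for \<open>V = H10 \<Omega>\<close>, the
  finite element problem for \<open>V = fe_space \<Omega> T\<close>.\<close>

definition pnp_solution ::
    "'a::euclidean_space set \<Rightarrow> (nat \<Rightarrow> 'a \<Rightarrow> real) \<Rightarrow> ('a \<Rightarrow> real) set \<Rightarrow>
     (nat \<Rightarrow> 'a \<Rightarrow> real) \<Rightarrow> ('a \<Rightarrow> real) \<Rightarrow> bool" where
  "pnp_solution \<Omega> F V p \<phi> \<longleftrightarrow>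
     \<phi> \<in> V \<and> (\<forall>i \<in> {1, 2}. p i \<in> V) \<and>
     (\<forall>i \<in> {1, 2}. nernst_planck_eq \<Omega> F V i (p i) (p i) \<phi>) \<and>
     poisson_eq \<Omega> F V p \<phi>"

text \<open>The semi-decoupled two-grid solution in the fine space \<open>V\<close>, for given coarse
  concentrations \<open>pH\<close>.\<close>

definition two_grid_solution ::
    "'a::euclidean_space set \<Rightarrow> (nat \<Rightarrow> 'a \<Rightarrow> real) \<Rightarrow> ('a \<Rightarrow> real) set \<Rightarrow>
     (nat \<Rightarrow> 'a \<Rightarrow> real) \<Rightarrow> (nat \<Rightarrow> 'a \<Rightarrow> real) \<Rightarrow> ('a \<Rightarrow> real) \<Rightarrow> bool" where
  "two_grid_solution \<Omega> F V pH p \<phi> \<longleftrightarrow>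
     \<phi> \<in> V \<and> (\<forall>i \<in> {1, 2}. p i \<in> V) \<and>
     poisson_eq \<Omega> F V pH \<phi> \<and>
     (\<forall>i \<in> {1, 2}. nernst_planck_eq \<Omega> F V i (pH i) (p i) \<phi>)"

text \<open>Unique existence for a problem in the unknowns \<open>(p, \<phi>)\<close>, modulo null sets of \<open>\<Omega>\<close>.\<close>

definition uniquely_solvable ::
    "'a::euclidean_space set \<Rightarrow> ((nat \<Rightarrow> 'a \<Rightarrow> real) \<Rightarrow> ('a \<Rightarrow> real) \<Rightarrow> bool) \<Rightarrow> bool" where
  "uniquely_solvable \<Omega> P \<longleftrightarrow>
     (\<exists>p \<phi>. P p \<phi>) \<and>
     (\<forall>p \<phi> p' \<phi>'. P p \<phi> \<longrightarrow> P p' \<phi>' \<longrightarrow>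
        (AE x in lebesgue_on \<Omega>. \<phi> x = \<phi>' x) \<and>
        (\<forall>i \<in> {1, 2}. AE x in lebesgue_on \<Omega>. p i x = p' i x))"

end

theory Submission
  imports Defs "HOL-Computational_Algebra.Polynomial"
begin

text \<open>With \<open>w = \<phi>\<^sub>h - \<phi>\<^sub>s\<close> as test function, subtracting the two Poisson equations gives
  \<open>\<parallel>\<nabla>w\<parallel>\<^sup>2 = \<Sum>\<^sub>i q\<^sup>i (p\<^sub>h\<^sup>i - p\<^sub>H\<^sup>i, w)\<close>, and Cauchy-Schwarz followed by the Poincare inequality bounds
  this by \<open>C (\<Sum>\<^sub>i \<parallel>p\<^sub>h\<^sup>i - p\<^sub>H\<^sup>i\<parallel>) \<parallel>\<nabla>w\<parallel>\<close>; the constant is the diameter of an enclosing ball.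
  For finite element functions the Poincare inequality is elementary: their zero extensions are
  Lipschitz and differentiable off the boundaries of the elements, and derivatives of compactly
  supported Lipschitz functions have mean zero. The classical gradient is thereby a weak gradient,
  and it agrees with \<open>wgrad\<close> because weak gradients are unique: testing with smooth bumps shows that
  a function orthogonal to all test functions has mean zero over every box, hence vanishes at its
  Lebesgue points.\<close>

section \<open>Smooth bump functions\<close>

text \<open>The factor \<open>poly p (1 / t)\<close> makes this family closed under differentiation,
  so all derivatives of \<open>exp (- 1 / t)\<close>, extended by 0 to \<open>t \<le> 0\<close>, are
  treated at once.\<close>

definition flat :: "real poly \<Rightarrow> real \<Rightarrow> real" where
  "flat p t = (if t > 0 then poly p (1 / t) * exp (- (1 / t)) else 0)"

lemma tendsto_poly_times_exp_minus: "((\<lambda>y. poly p y * exp (- y)) \<longlongrightarrow> 0) at_top" for p :: "real poly"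
proof -
  have "((\<lambda>y. \<Sum>i\<le>degree p. coeff p i * (y ^ i / exp y)) \<longlongrightarrow> (\<Sum>i\<le>degree p. coeff p i * 0)) at_top"
    by (intro tendsto_intros tendsto_power_div_exp_0)
  then show ?thesis
    by (simp add: poly_altdef exp_minus field_simps sum_divide_distrib)
qed

text \<open>For \<open>t > 0\<close> the product and chain rules give
  \<open>(1/t)^2 * (p(1/t) - p'(1/t)) * exp (- 1/t)\<close>; the polynomial
  \<open>[:0, 0, 1:]\<close> supplies the factor \<open>(1/t)^2\<close>. At 0 exponential decay
  beats every polynomial.\<close>

lemma has_real_derivative_flat:
  "(flat p has_real_derivative flat ([:0, 0, 1:] * (p - pderiv p)) t) (at t)"
proof -
  consider "t < 0" | "t = 0" | "t > 0" by linarith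
  then show ?thesis
  proof cases
    case 1
    have "((\<lambda>_. 0) has_real_derivative 0) (at t)" by simp
    then have "(flat p has_real_derivative 0) (at t)"
      by (rule DERIV_cong_ev[THEN iffD1, rotated -1])
        (use 1 in \<open>auto simp: flat_def intro: eventually_mono[OF eventually_nhds_in_open[of "{..<0}"]]\<close>)
    with 1 show ?thesis by (simp add: flat_def)
  next
    case 2
    \<comment> \<open>The difference quotient at 0 carries an extra factor \<open>1 / h\<close>;
      with \<open>y = 1 / h\<close> this turns \<open>p\<close> into
      \<open>pCons 0 p\<close>.\<close>
    have "((\<lambda>y. poly (pCons 0 p) y * exp (- y)) \<longlongrightarrow> 0) at_top"
      by (rule tendsto_poly_times_exp_minus)
    then have "((\<lambda>h. poly (pCons 0 p) (inverse h) * exp (- inverse h)) \<longlongrightarrow> 0) (at_right 0)"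
      by (rule filterlim_compose[OF _ filterlim_inverse_at_top_right])
    then have r: "((\<lambda>h. flat p h / h) \<longlongrightarrow> 0) (at_right 0)"
      by (rule Lim_transform_eventually)
        (auto simp: eventually_at_right_field flat_def field_simps intro!: exI[of _ 1])
    have l: "((\<lambda>h. flat p h / h) \<longlongrightarrow> 0) (at_left 0)"
      by (rule tendsto_eventually) (auto simp: eventually_at_left_field flat_def intro!: exI[of _ "-1"])
    have "((\<lambda>h. flat p h / h) \<longlongrightarrow> 0) (at 0)"
      using l r by (simp add: filterlim_at_split)
    with 2 show ?thesis by (simp add: DERIV_def flat_def)
  next
    case 3
    have "((\<lambda>t. poly p (1 / t) * exp (- (1 / t))) has_real_derivative
        flat ([:0, 0, 1:] * (p - pderiv p)) t) (at t)"
      using 3 by (auto intro!: derivative_eq_intros DERIV_chain'[of "\<lambda>t. 1 / t", OF _ poly_DERIV]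
          simp: flat_def field_simps power2_eq_square)
    then show ?thesis
      by (rule DERIV_cong_ev[THEN iffD1, rotated -1])
        (use 3 in \<open>auto simp: flat_def intro: eventually_mono[OF eventually_nhds_in_open[of "{0<..}"]]\<close>)
  qed
qed

lemma flat_one_bounds: "0 \<le> flat 1 t" "flat 1 t \<le> 1"
  by (auto simp: flat_def)

lemma flat_one_tendsto_indicator:
  "(\<lambda>n. flat 1 (real n * t)) \<longlonglongrightarrow> (if t > 0 then 1 else 0)"
proof (cases "t > 0")
  case True
  have "(\<lambda>n. exp (- (1 / t) * (1 / real n))) \<longlonglongrightarrow> exp (- (1 / t) * 0)"
    by (intro tendsto_intros lim_1_over_n)
  moreover have "\<forall>\<^sub>F n in sequentially. exp (- (1 / t) * (1 / real n)) = flat 1 (real n * t)"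
    using eventually_gt_at_top[of 0] by eventually_elim (use True in \<open>simp add: flat_def\<close>)
  ultimately have "(\<lambda>n. flat 1 (real n * t)) \<longlonglongrightarrow> 1"
    by (auto dest: Lim_transform_eventually)
  with True show ?thesis by simp
next
  case False
  then have "flat 1 (real n * t) = 0" for n
    by (auto simp: flat_def zero_less_mult_iff)
  with False show ?thesis by simp
qed

section \<open>Calculus of k times continuously differentiable functions\<close>

lemma Ck_SucD: "Ck (Suc k) f \<Longrightarrow> Ck k f"
  by (induction k arbitrary: f) (auto simp: differentiable_imp_continuous_on)

lemma Ck_const: "Ck k (\<lambda>x. c)"
  by (induction k arbitrary: c) auto

text \<open>Replaces \<open>frechet_derivative\<close> in the definition of \<open>Ck\<close> by any
  explicitly computed derivative.\<close>

lemma Ck_SucI: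
  assumes "\<And>x. (f has_derivative f' x) (at x)" and "\<And>i. i \<in> Basis \<Longrightarrow> Ck k (\<lambda>x. f' x i)"
  shows "Ck (Suc k) f"
proof -
  have "frechet_derivative f (at x) = f' x" for x
    using frechet_derivative_at[OF assms(1)] by simp
  then show ?thesis
    using assms by (auto simp: differentiable_on_def intro: differentiableI differentiable_at_withinI)
qed

lemma Ck_has_derivative:
  "Ck (Suc k) f \<Longrightarrow> (f has_derivative frechet_derivative f (at x)) (at x)"
  by (auto simp: differentiable_on_def frechet_derivative_works)

lemma Ck_add:
  fixes f g :: "'a::euclidean_space \<Rightarrow> real"
  shows "Ck k f \<Longrightarrow> Ck k g \<Longrightarrow> Ck k (\<lambda>x. f x + g x)"
proof (induction k arbitrary: f g)
  case 0
  then show ?case by (auto intro!: continuous_intros)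
next
  case (Suc k)
  have d: "((\<lambda>x. f x + g x) has_derivative (\<lambda>h. frechet_derivative f (at x) h
      + frechet_derivative g (at x) h)) (at x)" for x
    by (intro has_derivative_add Ck_has_derivative[of k] Suc.prems)
  show ?case
    by (rule Ck_SucI[OF d], rule Suc.IH) (use Suc.prems in simp_all)
qed

lemma Ck_mult:
  fixes f g :: "'a::euclidean_space \<Rightarrow> real"
  shows "Ck k f \<Longrightarrow> Ck k g \<Longrightarrow> Ck k (\<lambda>x. f x * g x)"
proof (induction k arbitrary: f g)
  case 0
  then show ?case by (auto intro!: continuous_intros)
next
  case (Suc k)
  have d: "((\<lambda>x. f x * g x) has_derivative (\<lambda>h. f x * frechet_derivative g (at x) h
      + frechet_derivative f (at x) h * g x)) (at x)" for x
    by (intro has_derivative_mult Ck_has_derivative[of k] Suc.prems)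
  show ?case
  proof (rule Ck_SucI[OF d])
    fix i :: 'a assume "i \<in> Basis"
    then have "Ck k (\<lambda>x. frechet_derivative f (at x) i)" "Ck k (\<lambda>x. frechet_derivative g (at x) i)"
      using Suc.prems by simp_all
    then show "Ck k (\<lambda>x. f x * frechet_derivative g (at x) i + frechet_derivative f (at x) i * g x)"
      \<comment> \<open>The undifferentiated factors are of class \<open>Suc k\<close>; they are
        lowered to class \<open>k\<close> to match the induction hypothesis.\<close>
      by (intro Ck_add Suc.IH Ck_SucD[OF Suc.prems(1)] Ck_SucD[OF Suc.prems(2)])
  qed
qed

lemma Ck_prod: "(\<And>i. i \<in> A \<Longrightarrow> Ck k (f i)) \<Longrightarrow> Ck k (\<lambda>x. \<Prod>i\<in>A. f i x)"
  by (induction A rule: infinite_finite_induct) (simp_all add: Ck_const Ck_mult)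

text \<open>A partial derivative has the same form with another constant and another polynomial, so
  the induction on \<open>k\<close> runs with \<open>c\<close> and \<open>p\<close>
  arbitrary.\<close>

lemma Ck_flat_affine: "Ck k (\<lambda>x. c * flat p (x \<bullet> u + d))"
proof (induction k arbitrary: c p)
  case 0
  have "continuous_on UNIV (flat p)"
    by (rule DERIV_continuous_on) (rule has_field_derivative_at_within[OF has_real_derivative_flat])
  then have "continuous_on UNIV (\<lambda>x. flat p (x \<bullet> u + d))"
    by (rule continuous_on_compose2) (intro continuous_intros, simp)
  then show ?case by (simp add: continuous_on_mult_left)
next
  case (Suc k)
  let ?p' = "[:0, 0, 1:] * (p - pderiv p)"
  have d: "((\<lambda>x. c * flat p (x \<bullet> u + d)) has_derivative
      (\<lambda>h. (c * (h \<bullet> u)) * flat ?p' (x \<bullet> u + d))) (at x)" for x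
  proof -
    have "((\<lambda>x. x \<bullet> u + d) has_derivative (\<lambda>h. h \<bullet> u)) (at x)"
      by (auto intro!: derivative_eq_intros)
    from has_derivative_mult_right[OF DERIV_compose_FDERIV[OF has_real_derivative_flat this], of c]
    show ?thesis by (simp only: mult.assoc)
  qed
  show ?case
    by (rule Ck_SucI[OF d Suc])
qed

text \<open>As \<open>n\<close> grows, \<open>flat 1 (n * t) = exp (- 1 / (n * t))\<close> tends to the indicator of \<open>t > 0\<close>, so these
  products tend to the indicator of the open box.\<close>

definition box_bump :: "nat \<Rightarrow> 'a::euclidean_space \<Rightarrow> 'a \<Rightarrow> 'a \<Rightarrow> real" where
  "box_bump n a b x =
     (\<Prod>i\<in>Basis. flat 1 (real n * (x \<bullet> i - a \<bullet> i)) * flat 1 (real n * (b \<bullet> i - x \<bullet> i)))"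

lemma Ck_box_bump: "Ck k (box_bump n a b)"
proof -
  have "Ck k (\<lambda>x. flat 1 (real n * (x \<bullet> i - a \<bullet> i)) * flat 1 (real n * (b \<bullet> i - x \<bullet> i)))" for i
    using Ck_mult[OF Ck_flat_affine[of k 1 1 "real n *\<^sub>R i" "- real n * (a \<bullet> i)"]
        Ck_flat_affine[of k 1 1 "- real n *\<^sub>R i" "real n * (b \<bullet> i)"]]
    by (simp add: algebra_simps)
  then show ?thesis
    unfolding box_bump_def by (rule Ck_prod)
qed

lemma box_bump_bounds: "0 \<le> box_bump n a b x" "box_bump n a b x \<le> 1"
  unfolding box_bump_def by (intro prod_nonneg prod_le_1 conjI ballI mult_nonneg_nonneg mult_le_one flat_one_bounds)+

lemma box_bump_eq_0:
  assumes "x \<notin> box a b"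
  shows "box_bump n a b x = 0"
proof -
  obtain i where "i \<in> Basis" "x \<bullet> i \<le> a \<bullet> i \<or> b \<bullet> i \<le> x \<bullet> i"
    using assms by (force simp: mem_box)
  then have "flat 1 (real n * (x \<bullet> i - a \<bullet> i)) * flat 1 (real n * (b \<bullet> i - x \<bullet> i)) = 0"
    by (auto simp: flat_def zero_less_mult_iff)
  with \<open>i \<in> Basis\<close> show ?thesis
    unfolding box_bump_def by (intro prod_zero) auto
qed

lemma box_bump_tendsto_indicator: "(\<lambda>n. box_bump n a b x) \<longlonglongrightarrow> indicator (box a b) x"
proof (cases "x \<in> box a b")
  case True
  have "(\<lambda>n. box_bump n a b x) \<longlonglongrightarrow>
      (\<Prod>i\<in>Basis. (if x \<bullet> i - a \<bullet> i > 0 then 1 else 0) * (if b \<bullet> i - x \<bullet> i > 0 then 1 else 0))"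
    unfolding box_bump_def by (intro tendsto_intros flat_one_tendsto_indicator)
  also have "(\<Prod>i\<in>Basis. (if x \<bullet> i - a \<bullet> i > 0 then 1 else 0) * (if b \<bullet> i - x \<bullet> i > 0 then 1 else (0::real))) = 1"
    using True by (intro prod.neutral) (auto simp: mem_box)
  finally show ?thesis using True by simp
next
  case False
  then show ?thesis by (simp add: box_bump_eq_0)
qed

lemma test_function_box_bump:
  assumes "cbox a b \<subseteq> \<Omega>"
  shows "test_function \<Omega> (box_bump n a b)"
  unfolding test_function_def
  by (intro conjI allI exI[of _ "cbox a b"])
    (use assms box_subset_cbox[of a b] in \<open>auto intro: Ck_box_bump box_bump_eq_0\<close>)

section \<open>The fundamental lemma of the calculus of variations\<close>

lemma AE_zero_if_test_integrals_zero:
  fixes f :: "'a::euclidean_space \<Rightarrow> real"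
  assumes "open \<Omega>" and f: "integrable (lebesgue_on \<Omega>) f"
    and zero: "\<And>\<phi>. test_function \<Omega> \<phi> \<Longrightarrow> (LINT x | lebesgue_on \<Omega>. f x * \<phi> x) = 0"
  shows "AE x in lebesgue_on \<Omega>. f x = 0"
proof -
  define F where "F x = (if x \<in> \<Omega> then f x else 0)" for x
  have \<Omega>: "\<Omega> \<in> sets lebesgue" using \<open>open \<Omega>\<close> by auto
  have F: "integrable lebesgue F"
    unfolding F_def by (subst Lebesgue_Measure.integrable_restrict_UNIV) (use \<Omega> f in auto)
  have Fon: "F integrable_on S" if "S \<in> sets lebesgue" for S
    by (rule integrable_on_lebesgue_on)
      (use that integrable_restrict_space[of S lebesgue F] integrable_mult_indicator[OF that F] in auto)
  have box0: "integral (cbox a b) F = 0" if "cbox a b \<subseteq> \<Omega>" for a b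
  proof -
    have F': "integrable (lebesgue_on (cbox a b)) F"
      using integrable_mult_indicator[OF _ F, of "cbox a b"] by (simp add: integrable_restrict_space)
    have lim: "AE x in lebesgue. (\<lambda>n. F x * box_bump n a b x) \<longlonglongrightarrow> indicator (cbox a b) x * F x"
    proof -
      \<comment> \<open>The bumps converge to the indicator of the open box, while the integral is
        over the closed one; the faces between them are a null set.\<close>
      have "AE x in lebesgue. x \<notin> cbox a b - box a b"
        by (intro AE_not_in) (simp add: negligible_iff_null_sets[symmetric] negligible_frontier_interval)
      then show ?thesis
      proof eventually_elim
        case (elim x)
        then have "indicator (cbox a b) x * F x = F x * indicator (box a b) x"
          using box_subset_cbox[of a b] by (auto simp: indicator_def)
        then show ?case by (simp only:) (intro tendsto_intros box_bump_tendsto_indicator)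
      qed
    qed
    have meas: "box_bump n a b \<in> borel_measurable lebesgue" for n
      using Ck_box_bump[of 0 n a b] by (auto intro!: measurable_completion borel_measurable_continuous_onI)
    have [measurable]: "indicat_real (cbox a b) \<in> borel_measurable lebesgue"
      by (auto intro: measurable_completion)
    \<comment> \<open>As the bumps take values between 0 and 1, \<open>\<bar>F x\<bar>\<close>
      dominates.\<close>
    have "(\<lambda>n. LINT x|lebesgue. F x * box_bump n a b x) \<longlonglongrightarrow> (LINT x|lebesgue. indicator (cbox a b) x * F x)"
      by (rule integral_dominated_convergence[where w = "\<lambda>x. \<bar>F x\<bar>", OF _ _ _ lim])
        (use F meas in \<open>auto intro!: borel_measurable_times mult_left_le simp: abs_mult box_bump_bounds abs_of_nonneg\<close>)
    moreover have "(LINT x|lebesgue. F x * box_bump n a b x) = 0" for n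
    proof -
      have "(LINT x|lebesgue. F x * box_bump n a b x) = (LINT x|lebesgue. (if x \<in> \<Omega> then f x * box_bump n a b x else 0))"
        by (intro Bochner_Integration.integral_cong) (auto simp: F_def)
      also have "\<dots> = (LINT x | lebesgue_on \<Omega>. f x * box_bump n a b x)"
        by (rule Lebesgue_Measure.integral_restrict_UNIV[OF \<Omega>])
      finally show ?thesis
        using zero[OF test_function_box_bump[OF that]] by simp
    qed
    ultimately have "(LINT x|lebesgue. indicator (cbox a b) x * F x) = 0"
      by (simp add: LIMSEQ_const_iff)
    then have "(LINT x|lebesgue_on (cbox a b). F x) = 0"
      by (subst integral_restrict_space) auto
    then show ?thesis
      using lebesgue_integral_eq_integral[OF F'] by simp
  qed
  \<comment> \<open>Lebesgue differentiation: off a null set, \<open>F x\<close> is the limit of the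
    averages of \<open>F\<close> over the cubes with lower corner \<open>x\<close>.\<close>
  obtain N where N: "negligible N" and avg: "\<And>x e. \<lbrakk>x \<notin> N; 0 < e\<rbrakk> \<Longrightarrow>
      \<exists>d>0. \<forall>h. 0 < h \<and> h < d \<longrightarrow> norm (integral (cbox x (x + h *\<^sub>R One)) F /\<^sub>R h ^ DIM('a) - F x) < e"
    using integrable_ccontinuous_explicit[of F] Fon by (metis lmeasurable_cbox fmeasurableD)
  have "f x = 0" if "x \<in> \<Omega>" "x \<notin> N" for x
  proof (rule ccontr)
    assume "f x \<noteq> 0"
    then obtain d where "d > 0" and d: "\<And>h. 0 < h \<and> h < d \<Longrightarrow>
        norm (integral (cbox x (x + h *\<^sub>R One)) F /\<^sub>R h ^ DIM('a) - F x) < norm (f x)"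
      using avg[OF \<open>x \<notin> N\<close>, of "norm (f x)"] by auto
    obtain r where "r > 0" "cball x r \<subseteq> \<Omega>"
      using \<open>open \<Omega>\<close> \<open>x \<in> \<Omega>\<close> open_contains_cball by blast
    \<comment> \<open>The first bound keeps \<open>h\<close> below \<open>d\<close>; the second
      keeps the cube inside the ball, since the norm is at most the sum of the
      \<open>DIM('a)\<close> coordinates.\<close>
    define h where "h = min (d / 2) (r / DIM('a))"
    have h: "0 < h" "h < d" "h * DIM('a) \<le> r"
      using \<open>d > 0\<close> \<open>r > 0\<close> by (auto simp: h_def min_def field_simps)
    have "cbox x (x + h *\<^sub>R One) \<subseteq> cball x r"
    proof
      fix y assume y: "y \<in> cbox x (x + h *\<^sub>R One)"
      have "norm (y - x) \<le> (\<Sum>i\<in>Basis. \<bar>(y - x) \<bullet> i\<bar>)" by (rule norm_le_l1)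
      also have "\<dots> \<le> (\<Sum>i\<in>(Basis::'a set). h)"
        using y by (intro sum_mono) (auto simp: mem_box inner_simps)
      also have "\<dots> \<le> r" using h by (simp add: mult.commute)
      finally show "y \<in> cball x r" by (simp add: dist_norm norm_minus_commute)
    qed
    with \<open>cball x r \<subseteq> \<Omega>\<close> have "integral (cbox x (x + h *\<^sub>R One)) F = 0"
      by (intro box0) auto
    with d[of h] h \<open>x \<in> \<Omega>\<close> show False by (simp add: F_def)
  qed
  moreover have "AE x in lebesgue. x \<notin> N"
    using N by (intro AE_not_in) (simp add: negligible_iff_null_sets)
  ultimately show ?thesis
    using \<Omega> by (subst AE_restrict_space_iff) (auto elim: eventually_mono)
qed

section \<open>Integration by parts for Lipschitz functions\<close>

text \<open>Translation invariance is inherited from \<open>lborel\<close>; Borel measurability of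
  \<open>f\<close> allows the passage between \<open>lebesgue\<close> and
  \<open>lborel\<close>.\<close>

lemma integral_lebesgue_translation:
  fixes f :: "'a::euclidean_space \<Rightarrow> real"
  assumes f: "f \<in> borel_measurable borel"
  shows "(LINT x|lebesgue. f (x + c)) = (LINT x|lebesgue. f x)"
proof -
  have "(LINT x|lebesgue. f x) = (LINT x|lborel. f x)"
    using f by (simp add: integral_completion)
  also have "\<dots> = (LINT x|distr lborel borel (\<lambda>x. c + x). f x)"
    using lborel_affine[of 1 c] by (simp add: density_1)
  also have "\<dots> = (LINT x|lborel. f (c + x))"
    using f by (subst integral_distr) auto
  also have "\<dots> = (LINT x|lebesgue. f (x + c))"
    using f by (subst integral_completion) (auto simp: add.commute)
  finally show ?thesis ..
qed

text \<open>A sequence of step sizes, rather than a real limit, suits dominated convergence and the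
  measurability of limits.\<close>

lemma has_derivative_difference_quotient:
  fixes f :: "'a::real_normed_vector \<Rightarrow> real"
  assumes "(f has_derivative D) (at x)"
  shows "(\<lambda>n. (f (x + (1 / real (Suc n)) *\<^sub>R u) - f x) * real (Suc n)) \<longlonglongrightarrow> D u"
proof -
  have "((\<lambda>t. x + t *\<^sub>R u) has_derivative (\<lambda>t. t *\<^sub>R u)) (at 0)"
    by (auto intro!: derivative_eq_intros)
  moreover have "(f has_derivative D) (at (x + 0 *\<^sub>R u))"
    using assms by simp
  ultimately have "((\<lambda>t. f (x + t *\<^sub>R u)) has_derivative (\<lambda>t. D (t *\<^sub>R u))) (at 0)"
    by (rule has_derivative_compose)
  moreover have "D (t *\<^sub>R u) = D u * t" for t
    using linear_scale[OF has_derivative_linear[OF assms]] by simp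
  ultimately have "((\<lambda>t. f (x + t *\<^sub>R u)) has_real_derivative D u) (at 0)"
    by (simp add: has_field_derivative_def mult_commute_abs)
  then have "((\<lambda>t. (f (x + t *\<^sub>R u) - f x) / t) \<longlongrightarrow> D u) (at 0)"
    by (simp add: DERIV_def)
  moreover have "filterlim (\<lambda>n. 1 / real (Suc n)) (at 0) sequentially"
    unfolding filterlim_at using LIMSEQ_inverse_real_of_nat by (auto simp: inverse_eq_divide)
  ultimately have "(\<lambda>n. (f (x + (1 / real (Suc n)) *\<^sub>R u) - f x) / (1 / real (Suc n))) \<longlonglongrightarrow> D u"
    by (rule filterlim_compose)
  then show ?thesis by simp
qed

text \<open>The mean of a difference quotient vanishes by translation invariance; the Lipschitz bound
  dominates the passage to the limit.\<close>

lemma integral_derivative_eq_0: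
  fixes \<psi> :: "'a::euclidean_space \<Rightarrow> real"
  assumes lip: "L-lipschitz_on UNIV \<psi>" and supp: "\<And>x. x \<notin> cball 0 R \<Longrightarrow> \<psi> x = 0"
    and der: "AE x in lebesgue. (\<psi> has_derivative D x) (at x)"
    and meas: "(\<lambda>x. D x u) \<in> borel_measurable lebesgue"
  shows "integrable lebesgue (\<lambda>x. D x u)" and "(LINT x|lebesgue. D x u) = 0"
proof -
  let ?s = "\<lambda>n x. (\<psi> (x + (1 / real (Suc n)) *\<^sub>R u) - \<psi> x) * real (Suc n)"
  \<comment> \<open>The Lipschitz bound controls each quotient by \<open>L * norm u\<close>. The
    steps have length at most \<open>norm u\<close>, so all quotients vanish outside the ball
    enlarged by \<open>norm u\<close>.\<close>
  let ?w = "\<lambda>x. L * norm u * indicator (cball 0 (R + norm u)) x :: real"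
  have cont: "continuous_on UNIV \<psi>"
    using lip by (rule lipschitz_on_continuous_on)
  then have [measurable]: "\<psi> \<in> borel_measurable borel"
    by (rule borel_measurable_continuous_onI)
  have L: "L \<ge> 0" using lip lipschitz_on_nonneg by blast
  have s: "?s n \<in> borel_measurable lebesgue" for n
    by (rule measurable_completion) measurable
  have w: "integrable lebesgue ?w"
    by (intro integrable_mult_right) (simp add: lmeasurable_iff_integrable[symmetric])
  have bound: "norm (?s n x) \<le> ?w x" for n x
  proof (cases "x \<in> cball 0 (R + norm u)")
    case True
    have "\<bar>\<psi> (x + (1 / real (Suc n)) *\<^sub>R u) - \<psi> x\<bar> \<le> L * (norm u / real (Suc n))"
      using lipschitz_onD[OF lip, of "x + (1 / real (Suc n)) *\<^sub>R u" x] by (simp add: dist_norm)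
    then have "\<bar>\<psi> (x + (1 / real (Suc n)) *\<^sub>R u) - \<psi> x\<bar> * real (Suc n) \<le> L * norm u"
      by (simp add: field_simps)
    with True show ?thesis by (simp add: abs_mult)
  next
    case False
    have "norm ((1 / real (Suc n)) *\<^sub>R u) \<le> norm u"
      by (simp add: divide_le_eq mult_le_cancel_left1)
    moreover have "norm x \<le> norm (x + (1 / real (Suc n)) *\<^sub>R u) + norm ((1 / real (Suc n)) *\<^sub>R u)"
      by (metis add_diff_cancel norm_triangle_ineq4)
    moreover have "norm u \<ge> 0" "R + norm u < norm x" using False by auto
    ultimately have "x + (1 / real (Suc n)) *\<^sub>R u \<notin> cball 0 R" "x \<notin> cball 0 R"
      unfolding mem_cball_0 by linarith+
    then show ?thesis using L by (simp add: supp)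
  qed
  have lim: "AE x in lebesgue. (\<lambda>n. ?s n x) \<longlonglongrightarrow> D x u"
    using der by eventually_elim (rule has_derivative_difference_quotient)
  show "integrable lebesgue (\<lambda>x. D x u)"
    by (rule integrable_dominated_convergence[OF meas s w lim]) (use bound in auto)
  have "(\<lambda>n. LINT x|lebesgue. ?s n x) \<longlonglongrightarrow> (LINT x|lebesgue. D x u)"
    by (rule integral_dominated_convergence[OF meas s w lim]) (use bound in auto)
  moreover have "(LINT x|lebesgue. ?s n x) = 0" for n
  proof -
    \<comment> \<open>Both terms of the quotient have to be integrable before its integral splits
      into two equal integrals that cancel.\<close>
    have "integrable lborel (\<lambda>x. indicator (cball 0 R) x *\<^sub>R \<psi> x)"
      by (rule borel_integrable_compact) (auto intro: continuous_on_subset[OF cont])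
    also have "(\<lambda>x. indicator (cball 0 R) x *\<^sub>R \<psi> x) = \<psi>"
      using supp by (force simp: indicator_def)
    finally have int: "integrable lborel \<psi>" .
    have "integrable (distr lborel borel (\<lambda>x. (1 / real (Suc n)) *\<^sub>R u + x)) \<psi>"
      using int lborel_affine[of 1 "(1 / real (Suc n)) *\<^sub>R u"] by (simp add: density_1)
    then have int': "integrable lborel (\<lambda>x. \<psi> (x + (1 / real (Suc n)) *\<^sub>R u))"
      by (subst (asm) integrable_distr_eq) (auto simp: add.commute)
    show ?thesis
      using int int' integral_lebesgue_translation[of \<psi> "(1 / real (Suc n)) *\<^sub>R u"]
      by (simp add: integrable_completion)
  qed
  ultimately show "(LINT x|lebesgue. D x u) = 0"
    by (simp add: LIMSEQ_const_iff)
qed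

section \<open>Lipschitz bounds for products and for smooth functions\<close>

text \<open>Write \<open>f x * g x - f y * g y\<close> as
  \<open>(f x - f y) * g x + f y * (g x - g y)\<close>. For \<open>y\<close> outside
  \<open>S\<close> only the first term remains, so the behaviour of \<open>g\<close> off
  \<open>S\<close> is irrelevant.\<close>

lemma lipschitz_on_mult_compact_support:
  fixes f g :: "'a::metric_space \<Rightarrow> real"
  assumes f: "L-lipschitz_on UNIV f" and g: "M-lipschitz_on S g" and "compact S"
    and supp: "\<And>x. x \<notin> S \<Longrightarrow> f x = 0"
  obtains K where "K-lipschitz_on UNIV (\<lambda>x. f x * g x)"
proof -
  have "bounded (f ` S)" "bounded (g ` S)"
    using f g \<open>compact S\<close>
    by (auto intro!: compact_imp_bounded compact_continuous_image lipschitz_on_continuous_on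
        intro: lipschitz_on_subset)
  then obtain A B where A: "\<And>x. x \<in> S \<Longrightarrow> \<bar>f x\<bar> \<le> A" "A > 0" and B: "\<And>x. x \<in> S \<Longrightarrow> \<bar>g x\<bar> \<le> B" "B > 0"
    unfolding bounded_pos by (metis imageI real_norm_def)
  have LM: "L \<ge> 0" "M \<ge> 0" using f g lipschitz_on_nonneg by blast+
  have 1: "\<bar>f x * g x - f y * g y\<bar> \<le> (L * B + A * M) * dist x y" if "x \<in> S" for x y
  proof (cases "y \<in> S")
    case True
    have "\<bar>f x * g x - f y * g y\<bar> = \<bar>(f x - f y) * g x + f y * (g x - g y)\<bar>"
      by (simp add: algebra_simps)
    also have "\<dots> \<le> \<bar>f x - f y\<bar> * \<bar>g x\<bar> + \<bar>f y\<bar> * \<bar>g x - g y\<bar>"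
      by (metis abs_mult abs_triangle_ineq)
    also have "\<dots> \<le> (L * dist x y) * B + A * (M * dist x y)"
      using lipschitz_onD[OF f, of x y] lipschitz_onD[OF g \<open>x \<in> S\<close> True] A B LM that True
      by (intro add_mono mult_mono) (auto simp: dist_real_def)
    finally show ?thesis by (simp add: algebra_simps)
  next
    case False
    then have "\<bar>f x * g x - f y * g y\<bar> = \<bar>f x - f y\<bar> * \<bar>g x\<bar>"
      by (simp add: supp abs_mult)
    also have "\<dots> \<le> (L * dist x y) * B"
      using lipschitz_onD[OF f, of x y] B LM that by (intro mult_mono) (auto simp: dist_real_def)
    also have "\<dots> \<le> (L * B + A * M) * dist x y"
      using A LM by (simp add: algebra_simps)
    finally show ?thesis .
  qed
  have "(L * B + A * M)-lipschitz_on UNIV (\<lambda>x. f x * g x)"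
  proof (rule lipschitz_onI)
    fix x y
    show "dist (f x * g x) (f y * g y) \<le> (L * B + A * M) * dist x y"
      using 1[of x y] 1[of y x] A B LM
      by (cases "x \<in> S"; cases "y \<in> S") (auto simp: dist_real_def dist_commute supp abs_minus_commute)
  qed (use A B LM in auto)
  then show thesis by (rule that)
qed

text \<open>The mean value inequality on the convex set: the sum of the absolute partial derivatives
  dominates the operator norm and is bounded by compactness.\<close>

lemma Ck_lipschitz_on_compact_convex:
  fixes \<phi> :: "'a::euclidean_space \<Rightarrow> real"
  assumes "Ck 1 \<phi>" and S: "compact S" "convex S"
  obtains M where "M-lipschitz_on S \<phi>"
proof -
  let ?D = "\<lambda>x. frechet_derivative \<phi> (at x)"
  have der: "(\<phi> has_derivative ?D x) (at x)" for x
    using assms(1) Ck_has_derivative[of 0 \<phi>] by simp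
  have "continuous_on UNIV (\<lambda>x. ?D x i)" if "i \<in> Basis" for i
    using assms(1) that by simp
  then have "continuous_on S (\<lambda>x. \<Sum>i\<in>Basis. \<bar>?D x i\<bar>)"
    by (intro continuous_intros) (auto intro: continuous_on_subset)
  then have "bounded ((\<lambda>x. \<Sum>i\<in>Basis. \<bar>?D x i\<bar>) ` S)"
    using S by (intro compact_imp_bounded compact_continuous_image)
  then obtain M where "M > 0" and M: "\<And>x. x \<in> S \<Longrightarrow> (\<Sum>i\<in>Basis. \<bar>?D x i\<bar>) \<le> M"
    unfolding bounded_pos by (metis abs_le_D1 imageI real_norm_def)
  have "onorm (?D x) \<le> M" if "x \<in> S" for x
  proof (rule onorm_le)
    fix h
    have "?D x h = (\<Sum>i\<in>Basis. (h \<bullet> i) * ?D x i)"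
      using linear_sum[OF has_derivative_linear[OF der[of x]], of "\<lambda>i. (h \<bullet> i) *\<^sub>R i" Basis]
      by (simp add: euclidean_representation linear_scale[OF has_derivative_linear[OF der[of x]]])
    also have "norm \<dots> \<le> (\<Sum>i\<in>Basis. norm h * \<bar>?D x i\<bar>)"
      by (intro sum_norm_le) (auto simp: abs_mult intro!: mult_right_mono Basis_le_norm)
    also have "\<dots> \<le> M * norm h"
      using mult_left_mono[OF M[OF that] norm_ge_zero, of h]
      by (simp add: sum_distrib_left[symmetric] mult.commute)
    finally show "norm (?D x h) \<le> M * norm h" .
  qed
  then have "M-lipschitz_on S \<phi>"
    using \<open>M > 0\<close> differentiable_bound[OF \<open>convex S\<close> has_derivative_at_withinI[OF der]]
    by (intro lipschitz_onI) (auto simp: dist_norm)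
  then show thesis by (rule that)
qed

section \<open>Square-integrable functions and weak gradients\<close>

lemma L2_integrable_inner:
  assumes "f \<in> L2 \<Omega>" "g \<in> L2 \<Omega>"
  shows "integrable (lebesgue_on \<Omega>) (\<lambda>x. f x \<bullet> g x)"
proof (rule Bochner_Integration.integrable_bound)
  show "integrable (lebesgue_on \<Omega>) (\<lambda>x. (norm (f x))\<^sup>2 + (norm (g x))\<^sup>2)"
    using assms by (auto simp: L2_def)
  show "(\<lambda>x. f x \<bullet> g x) \<in> borel_measurable (lebesgue_on \<Omega>)"
    using assms by (auto simp: L2_def)
  show "AE x in lebesgue_on \<Omega>. norm (f x \<bullet> g x) \<le> norm ((norm (f x))\<^sup>2 + (norm (g x))\<^sup>2)"
  proof (rule AE_I2)
    fix x
    have "\<bar>f x \<bullet> g x\<bar> \<le> norm (f x) * norm (g x)" by (rule Cauchy_Schwarz_ineq2)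
    also have "\<dots> \<le> (norm (f x))\<^sup>2 + (norm (g x))\<^sup>2"
      using sum_squares_bound[of "norm (f x)" "norm (g x)"]
        mult_nonneg_nonneg[OF norm_ge_zero norm_ge_zero, of "f x" "g x"] by linarith
    finally show "norm (f x \<bullet> g x) \<le> norm ((norm (f x))\<^sup>2 + (norm (g x))\<^sup>2)" by simp
  qed
qed

lemma L2_diff:
  assumes "f \<in> L2 \<Omega>" "g \<in> L2 \<Omega>"
  shows "(\<lambda>x. f x - g x) \<in> L2 \<Omega>"
proof -
  have "(norm (f x - g x))\<^sup>2 = (norm (f x))\<^sup>2 + (norm (g x))\<^sup>2 - 2 * (f x \<bullet> g x)" for x
    by (simp add: power2_norm_eq_inner inner_diff_left inner_diff_right inner_commute)
  then show ?thesis
    using assms L2_integrable_inner[OF assms] by (auto simp: L2_def)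
qed

lemma L2_inner_component:
  assumes "g \<in> L2 \<Omega>" "i \<in> Basis"
  shows "(\<lambda>x. g x \<bullet> i) \<in> L2 \<Omega>"
proof -
  have [measurable]: "g \<in> borel_measurable (lebesgue_on \<Omega>)"
    and g: "integrable (lebesgue_on \<Omega>) (\<lambda>x. (norm (g x))\<^sup>2)"
    using assms by (auto simp: L2_def)
  have "integrable (lebesgue_on \<Omega>) (\<lambda>x. (norm (g x \<bullet> i))\<^sup>2)"
    by (rule Bochner_Integration.integrable_bound[OF g])
      (auto simp: abs_le_square_iff[symmetric] Basis_le_norm[OF \<open>i \<in> Basis\<close>])
  then show ?thesis by (simp add: L2_def)
qed

lemma L2_bounded:
  fixes g :: "'a::euclidean_space \<Rightarrow> 'b::euclidean_space"
  assumes "bounded \<Omega>" "\<Omega> \<in> sets lebesgue" and g: "g \<in> borel_measurable (lebesgue_on \<Omega>)"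
    and le: "AE x in lebesgue_on \<Omega>. norm (g x) \<le> L"
  shows "g \<in> L2 \<Omega>"
proof -
  have "\<Omega> \<in> lmeasurable"
    using assms bounded_set_imp_lmeasurable by blast
  then have "integrable lebesgue (\<lambda>x. indicator \<Omega> x *\<^sub>R L\<^sup>2)"
    by (simp add: lmeasurable_iff_integrable)
  then have "integrable (lebesgue_on \<Omega>) (\<lambda>_. L\<^sup>2)"
    using assms(2) by (subst integrable_restrict_space) auto
  then have "integrable (lebesgue_on \<Omega>) (\<lambda>x. (norm (g x))\<^sup>2)"
  proof (rule Bochner_Integration.integrable_bound)
    show "AE x in lebesgue_on \<Omega>. norm ((norm (g x))\<^sup>2) \<le> norm (L\<^sup>2)"
      using le by eventually_elim (simp add: power_mono)
  qed (use g in measurable)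
  with g show ?thesis by (simp add: L2_def)
qed

lemma l2_norm_nonneg: "0 \<le> l2_norm \<Omega> f"
  by (simp add: l2_norm_def)

lemma l2_norm_power2: "(l2_norm \<Omega> f)\<^sup>2 = l2_inner \<Omega> f f"
  by (simp add: l2_norm_def l2_inner_def power2_norm_eq_inner)

lemma l2_inner_diff_left:
  assumes "f \<in> L2 \<Omega>" "g \<in> L2 \<Omega>" "h \<in> L2 \<Omega>"
  shows "l2_inner \<Omega> (\<lambda>x. f x - g x) h = l2_inner \<Omega> f h - l2_inner \<Omega> g h"
  using L2_integrable_inner[of f \<Omega> h] L2_integrable_inner[of g \<Omega> h] assms
  by (simp add: l2_inner_def inner_diff_left)

text \<open>The discriminant argument for the nonnegative quadratic form
  \<open>\<integral> \<bar>s f - t g\<bar>^2\<close> in \<open>s\<close> and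
  \<open>t\<close>.\<close>

lemma l2_Cauchy_Schwarz:
  assumes f: "f \<in> L2 \<Omega>" and g: "g \<in> L2 \<Omega>"
  shows "\<bar>l2_inner \<Omega> f g\<bar> \<le> l2_norm \<Omega> f * l2_norm \<Omega> g"
proof -
  let ?A = "l2_inner \<Omega> f f" and ?B = "l2_inner \<Omega> f g" and ?C = "l2_inner \<Omega> g g"
  have quad: "0 \<le> s\<^sup>2 * ?A - 2 * s * t * ?B + t\<^sup>2 * ?C" for s t
  proof -
    have "0 \<le> (LINT x|lebesgue_on \<Omega>. (norm (s *\<^sub>R f x - t *\<^sub>R g x))\<^sup>2)"
      by (intro Bochner_Integration.integral_nonneg) simp
    also have "\<dots> = (LINT x|lebesgue_on \<Omega>. s\<^sup>2 * (f x \<bullet> f x) - 2 * s * t * (f x \<bullet> g x) + t\<^sup>2 * (g x \<bullet> g x))"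
      by (intro Bochner_Integration.integral_cong)
        (simp_all add: power2_norm_eq_inner inner_diff_left inner_diff_right inner_commute power2_eq_square[of s] power2_eq_square[of t] algebra_simps)
    also have "\<dots> = s\<^sup>2 * ?A - 2 * s * t * ?B + t\<^sup>2 * ?C"
      using L2_integrable_inner[OF f f] L2_integrable_inner[OF f g] L2_integrable_inner[OF g g]
      by (simp add: l2_inner_def)
    finally show ?thesis .
  qed
  have nonneg: "?A \<ge> 0" "?C \<ge> 0" using quad[of 1 0] quad[of 0 1] by auto
  have "?B\<^sup>2 \<le> ?A * ?C"
  proof (cases "?C = 0")
    case True
    have "?B = 0"
    proof (rule ccontr)
      assume "?B \<noteq> 0"
      \<comment> \<open>For this \<open>t\<close> the form equals
        \<open>?A - (?A + 1) = -1\<close>.\<close>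
      with quad[of 1 "(?A + 1) / (2 * ?B)"] True show False by simp
    qed
    with True show ?thesis by simp
  next
    case False
    \<comment> \<open>The choice \<open>s = ?C\<close>, \<open>t = ?B\<close> makes the form
      \<open>?C\<close> times the desired difference.\<close>
    have "0 \<le> ?C\<^sup>2 * ?A - 2 * ?C * ?B * ?B + ?B\<^sup>2 * ?C" by (rule quad)
    also have "\<dots> = ?C * (?A * ?C - ?B\<^sup>2)" by (simp add: power2_eq_square algebra_simps)
    finally show ?thesis using False nonneg by (simp add: zero_le_mult_iff)
  qed
  then have "?B\<^sup>2 \<le> (l2_norm \<Omega> f * l2_norm \<Omega> g)\<^sup>2"
    by (simp add: power_mult_distrib l2_norm_power2)
  then show ?thesis
    unfolding abs_le_square_iff[symmetric] by (simp add: abs_mult l2_norm_nonneg)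
qed

lemma integrable_continuous_compact_support:
  fixes f :: "'a::euclidean_space \<Rightarrow> real"
  assumes f: "continuous_on UNIV f" and "compact K" and "\<And>x. x \<notin> K \<Longrightarrow> f x = 0"
  shows "integrable lebesgue f"
proof -
  have "integrable lborel (\<lambda>x. indicator K x *\<^sub>R f x)"
    using \<open>compact K\<close> by (rule borel_integrable_compact) (rule continuous_on_subset[OF f], simp)
  also have "(\<lambda>x. indicator K x *\<^sub>R f x) = f"
    using assms(3) by (force simp: indicator_def)
  finally show ?thesis
    using borel_measurable_continuous_onI[OF f] by (simp add: integrable_completion)
qed

lemma integrable_lebesgue_on:
  fixes f :: "'a::euclidean_space \<Rightarrow> real"
  shows "integrable lebesgue f \<Longrightarrow> \<Omega> \<in> sets lebesgue \<Longrightarrow> integrable (lebesgue_on \<Omega>) f"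
  using integrable_mult_indicator[of \<Omega> lebesgue f] by (simp add: integrable_restrict_space)

lemma L2_continuous_compact_support:
  fixes f :: "'a::euclidean_space \<Rightarrow> real"
  assumes f: "continuous_on UNIV f" and "compact K" and "\<And>x. x \<notin> K \<Longrightarrow> f x = 0" and "\<Omega> \<in> sets lebesgue"
  shows "f \<in> L2 \<Omega>"
proof -
  have "f \<in> borel_measurable (lebesgue_on \<Omega>)"
    using borel_measurable_continuous_onI[OF f] by (auto intro!: measurable_restrict_space1 measurable_completion)
  moreover have "integrable lebesgue (\<lambda>x. (norm (f x))\<^sup>2)"
    using assms by (intro integrable_continuous_compact_support[of _ K] continuous_intros) auto
  ultimately show ?thesis
    using assms(4) by (simp add: L2_def integrable_lebesgue_on)
qed

lemma test_function_L2:
  assumes "test_function \<Omega> \<phi>" "\<Omega> \<in> sets lebesgue"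
  shows "\<phi> \<in> L2 \<Omega>"
proof -
  obtain K where "compact K" "\<forall>x. x \<notin> K \<longrightarrow> \<phi> x = 0" and "Ck 0 \<phi>"
    using assms(1) unfolding test_function_def by blast
  then show ?thesis
    using assms(2) by (intro L2_continuous_compact_support[of \<phi> K]) auto
qed

lemma weak_gradient_unique:
  assumes \<Omega>: "open \<Omega>" "bounded \<Omega>" and g: "has_weak_gradient \<Omega> v g" and h: "has_weak_gradient \<Omega> v h"
  shows "AE x in lebesgue_on \<Omega>. g x = h x"
proof -
  have leb: "\<Omega> \<in> sets lebesgue" using \<open>open \<Omega>\<close> by auto
  have d: "(\<lambda>x. g x - h x) \<in> L2 \<Omega>"
    using g h by (intro L2_diff) (auto simp: has_weak_gradient_def)
  have "AE x in lebesgue_on \<Omega>. (g x - h x) \<bullet> i = 0" if i: "i \<in> Basis" for i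
  proof (rule AE_zero_if_test_integrals_zero[OF \<open>open \<Omega>\<close>])
    \<comment> \<open>On a bounded domain the constant 1 is square-integrable, so pairing with it
      shows that square-integrable functions are integrable.\<close>
    have "(\<lambda>_. 1::real) \<in> L2 \<Omega>"
      using \<Omega> leb by (intro L2_bounded[where L = 1]) auto
    from L2_integrable_inner[OF L2_inner_component[OF d i] this]
    show "integrable (lebesgue_on \<Omega>) (\<lambda>x. (g x - h x) \<bullet> i)" by simp
  next
    fix \<phi> assume \<phi>: "test_function \<Omega> \<phi>"
    have "integrable (lebesgue_on \<Omega>) (\<lambda>x. (k x \<bullet> i) * \<phi> x)" if "k \<in> L2 \<Omega>" for k
      using L2_integrable_inner[OF L2_inner_component[OF that i] test_function_L2[OF \<phi> leb]] by simp
    then have "integrable (lebesgue_on \<Omega>) (\<lambda>x. (g x \<bullet> i) * \<phi> x)" "integrable (lebesgue_on \<Omega>) (\<lambda>x. (h x \<bullet> i) * \<phi> x)"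
      using g h by (auto simp: has_weak_gradient_def)
    moreover have "(LINT x|lebesgue_on \<Omega>. (g x \<bullet> i) * \<phi> x) = (LINT x|lebesgue_on \<Omega>. (h x \<bullet> i) * \<phi> x)"
      using g h \<phi> i unfolding has_weak_gradient_def by force
    ultimately show "(LINT x|lebesgue_on \<Omega>. (g x - h x) \<bullet> i * \<phi> x) = 0"
      by (simp add: inner_diff_left left_diff_distrib)
  qed
  then have "AE x in lebesgue_on \<Omega>. \<forall>i\<in>Basis. (g x - h x) \<bullet> i = 0"
    by (intro AE_finite_allI) auto
  then show ?thesis
    by eventually_elim (metis euclidean_eqI inner_zero_left right_minus_eq)
qed

section \<open>The Poincare inequality\<close>

text \<open>What the Poincare inequality uses of a finite element function extended by zero. Being
  Lipschitz on the whole space, \<open>f\<close> crosses the boundary of \<open>\<Omega>\<close>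
  without a jump, so no boundary terms arise.\<close>

locale lipschitz_gradient =
  fixes \<Omega> :: "'a::euclidean_space set" and R :: real and f :: "'a \<Rightarrow> real" and G :: "'a \<Rightarrow> 'a" and L :: real
  assumes open_domain: "open \<Omega>" and domain_cball: "\<Omega> \<subseteq> cball 0 R"
    and lip: "L-lipschitz_on UNIV f" and supp: "x \<notin> \<Omega> \<Longrightarrow> f x = 0"
    and G_meas: "G \<in> borel_measurable lebesgue"
    and G_bound: "AE x in lebesgue. norm (G x) \<le> L"
    and der: "AE x in lebesgue. (f has_derivative (\<lambda>h. G x \<bullet> h)) (at x)"
begin

lemma domain_lebesgue: "\<Omega> \<in> sets lebesgue"
  using open_domain by auto

lemma cont: "continuous_on UNIV f"
  using lip by (rule lipschitz_on_continuous_on)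

lemma supp_cball: "x \<notin> cball 0 R \<Longrightarrow> f x = 0"
  using supp domain_cball by blast

lemma f_L2: "f \<in> L2 \<Omega>"
  by (rule L2_continuous_compact_support[OF cont compact_cball supp_cball domain_lebesgue])

lemma G_L2: "G \<in> L2 \<Omega>"
proof (rule L2_bounded)
  show "bounded \<Omega>"
    using domain_cball bounded_cball bounded_subset by blast
  show "G \<in> borel_measurable (lebesgue_on \<Omega>)"
    using G_meas by (rule measurable_restrict_space1)
  show "AE x in lebesgue_on \<Omega>. norm (G x) \<le> L"
    using G_bound domain_lebesgue by (subst AE_restrict_space_iff) auto
qed (rule domain_lebesgue)

text \<open>The integrand is the derivative in direction \<open>u\<close> of the product
  \<open>f * g\<close>, which is globally Lipschitz with support in the ball and hence has
  derivatives of mean zero.\<close>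

lemma integral_by_parts:
  fixes g :: "'a \<Rightarrow> real"
  assumes g: "M-lipschitz_on (cball 0 R) g"
    and der_g: "AE x in lebesgue. (g has_derivative D x) (at x)"
    and meas: "g \<in> borel_measurable lebesgue" "(\<lambda>x. D x u) \<in> borel_measurable lebesgue"
  shows "integrable lebesgue (\<lambda>x. f x * D x u + (G x \<bullet> u) * g x)"
    and "(LINT x|lebesgue. f x * D x u + (G x \<bullet> u) * g x) = 0"
proof -
  obtain K where K: "K-lipschitz_on UNIV (\<lambda>x. f x * g x)"
    using lipschitz_on_mult_compact_support[OF lip g compact_cball supp_cball] by blast
  have d: "AE x in lebesgue. ((\<lambda>x. f x * g x) has_derivative (\<lambda>h. f x * D x h + (G x \<bullet> h) * g x)) (at x)"
    using der der_g by eventually_elim (rule has_derivative_mult)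
  have f: "f \<in> borel_measurable lebesgue"
    using borel_measurable_continuous_onI[OF cont] by (auto intro: measurable_completion)
  have m: "(\<lambda>x. f x * D x u + (G x \<bullet> u) * g x) \<in> borel_measurable lebesgue"
    using meas f G_meas by measurable
  note * = integral_derivative_eq_0[OF K, of R "\<lambda>x h. f x * D x h + (G x \<bullet> h) * g x" u]
  show "integrable lebesgue (\<lambda>x. f x * D x u + (G x \<bullet> u) * g x)"
    using *(1) d m supp_cball by simp
  show "(LINT x|lebesgue. f x * D x u + (G x \<bullet> u) * g x) = 0"
    using *(2) d m supp_cball by simp
qed

text \<open>Integration by parts over the whole space against the test function; \<open>f\<close>
  and the test function vanish off \<open>\<Omega>\<close>, so the integrals restrict to it.\<close>

lemma has_weak_gradient:
  assumes v: "\<And>x. x \<in> \<Omega> \<Longrightarrow> v x = f x"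
  shows "has_weak_gradient \<Omega> v G"
  unfolding has_weak_gradient_def
proof (intro conjI allI impI ballI)
  show "G \<in> L2 \<Omega>" by (rule G_L2)
next
  fix \<phi> :: "'a \<Rightarrow> real" and i :: 'a
  let ?D = "\<lambda>x. frechet_derivative \<phi> (at x)"
  assume \<phi>: "test_function \<Omega> \<phi>" and i: "i \<in> Basis"
  then have Ck: "Ck k \<phi>" for k by (simp add: test_function_def)
  have \<phi>0: "\<phi> x = 0" if "x \<notin> \<Omega>" for x
    using \<phi> that unfolding test_function_def by blast
  obtain M where M: "M-lipschitz_on (cball 0 R) \<phi>"
    using Ck_lipschitz_on_compact_convex[OF Ck compact_cball convex_cball] by blast
  have c: "continuous_on UNIV \<phi>" "continuous_on UNIV (\<lambda>x. ?D x i)"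
    using Ck[of 0] Ck[of 1] i by auto
  then have m: "\<phi> \<in> borel_measurable lebesgue" "(\<lambda>x. ?D x i) \<in> borel_measurable lebesgue"
    by (auto intro!: measurable_completion borel_measurable_continuous_onI)
  have d: "AE x in lebesgue. (\<phi> has_derivative ?D x) (at x)"
    using Ck_has_derivative[OF Ck] by simp
  have int1: "integrable lebesgue (\<lambda>x. f x * ?D x i)"
    using cont c supp_cball
    by (intro integrable_continuous_compact_support[of _ "cball 0 R"] continuous_intros) auto
  have int2: "integrable lebesgue (\<lambda>x. (G x \<bullet> i) * \<phi> x)"
    using Bochner_Integration.integrable_diff[OF integral_by_parts(1)[OF M d m] int1] by simp
  have "(LINT x | lebesgue_on \<Omega>. v x * ?D x i) = (LINT x|lebesgue. (if x \<in> \<Omega> then v x * ?D x i else 0))"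
    by (rule Lebesgue_Measure.integral_restrict_UNIV[OF domain_lebesgue, symmetric])
  also have "\<dots> = (LINT x|lebesgue. f x * ?D x i)"
    by (intro Bochner_Integration.integral_cong) (auto simp: v supp)
  also have "\<dots> = - (LINT x|lebesgue. (G x \<bullet> i) * \<phi> x)"
    using integral_by_parts(2)[OF M d m] int1 int2 by simp
  also have "(LINT x|lebesgue. (G x \<bullet> i) * \<phi> x) = (LINT x|lebesgue. (if x \<in> \<Omega> then (G x \<bullet> i) * \<phi> x else 0))"
    by (intro Bochner_Integration.integral_cong) (auto simp: \<phi>0)
  also have "\<dots> = (LINT x | lebesgue_on \<Omega>. (G x \<bullet> i) * \<phi> x)"
    by (rule Lebesgue_Measure.integral_restrict_UNIV[OF domain_lebesgue])
  finally show "(LINT x | lebesgue_on \<Omega>. v x * ?D x i) = - (LINT x | lebesgue_on \<Omega>. (G x \<bullet> i) * \<phi> x)" .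
qed

text \<open>Integration by parts against \<open>f x * (x \<bullet> i)\<close> gives
  \<open>\<integral> f\<^sup>2 = - 2 \<integral> f (G \<bullet> i) (x \<bullet> i)\<close>, and \<open>\<bar>x \<bullet> i\<bar> \<le> R\<close> on the domain.\<close>

lemma Poincare: "l2_norm \<Omega> f \<le> 2 * R * l2_norm \<Omega> G" if "R > 0"
proof -
  obtain i :: 'a where i: "i \<in> Basis" using nonempty_Basis by blast
  have "1-lipschitz_on (cball 0 R) (\<lambda>x::'a. x \<bullet> i)"
    using Basis_le_norm[OF i] by (intro lipschitz_onI) (auto simp: dist_norm inner_diff_left[symmetric])
  \<comment> \<open>Multiplying by the compactly supported \<open>f\<close> makes
    \<open>f x * (x \<bullet> i)\<close> Lipschitz, hence an admissible second factor for
    integration by parts.\<close>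
  then obtain K where "K-lipschitz_on UNIV (\<lambda>x. f x * (x \<bullet> i))"
    using lipschitz_on_mult_compact_support[OF lip _ compact_cball supp_cball] by blast
  then have K: "K-lipschitz_on (cball 0 R) (\<lambda>x. f x * (x \<bullet> i))"
    by (rule lipschitz_on_subset) simp
  have d: "AE x in lebesgue. ((\<lambda>x. f x * (x \<bullet> i)) has_derivative (\<lambda>h. f x * (h \<bullet> i) + (G x \<bullet> h) * (x \<bullet> i))) (at x)"
    using der by eventually_elim (auto intro!: derivative_eq_intros)
  have f: "f \<in> borel_measurable lebesgue"
    using borel_measurable_continuous_onI[OF cont] by (auto intro: measurable_completion)
  have xi: "(\<lambda>x::'a. x \<bullet> i) \<in> borel_measurable lebesgue"
    by (rule measurable_completion) measurable
  have m: "(\<lambda>x. f x * (x \<bullet> i)) \<in> borel_measurable lebesgue"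
    "(\<lambda>x. f x * (i \<bullet> i) + (G x \<bullet> i) * (x \<bullet> i)) \<in> borel_measurable lebesgue"
    using f xi G_meas by measurable
  let ?q = "\<lambda>x. f x * (f x * (i \<bullet> i) + (G x \<bullet> i) * (x \<bullet> i)) + (G x \<bullet> i) * (f x * (x \<bullet> i))"
  note q = integral_by_parts[OF K d m]
  have q_on: "integrable (lebesgue_on \<Omega>) ?q"
    using q(1) domain_lebesgue by (rule integrable_lebesgue_on)
  have "(LINT x|lebesgue_on \<Omega>. ?q x) = (LINT x|lebesgue. (if x \<in> \<Omega> then ?q x else 0))"
    by (rule Lebesgue_Measure.integral_restrict_UNIV[OF domain_lebesgue, symmetric])
  also have "\<dots> = (LINT x|lebesgue. ?q x)"
    by (intro Bochner_Integration.integral_cong) (auto simp: supp)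
  finally have q0: "(LINT x|lebesgue_on \<Omega>. ?q x) = 0"
    using q(2) by simp
  have f2: "integrable (lebesgue_on \<Omega>) (\<lambda>x. (norm (f x))\<^sup>2)" and G2: "integrable (lebesgue_on \<Omega>) (\<lambda>x. (norm (G x))\<^sup>2)"
    using f_L2 G_L2 by (auto simp: L2_def)
  \<comment> \<open>Young's inequality with weights chosen so that half of \<open>f^2\<close> is
    absorbed on the left; what remains gives the constant \<open>(2 * R)^2\<close>.\<close>
  have "(norm (f x))\<^sup>2 \<le> ?q x + (norm (f x))\<^sup>2 / 2 + 2 * R\<^sup>2 * (norm (G x))\<^sup>2" if "x \<in> \<Omega>" for x
  proof -
    have "\<bar>x \<bullet> i\<bar> \<le> R"
      using Basis_le_norm[OF i, of x] domain_cball that by (force simp: dist_norm)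
    then have "\<bar>(G x \<bullet> i) * (x \<bullet> i)\<bar> \<le> norm (G x) * R"
      unfolding abs_mult using Basis_le_norm[OF i, of "G x"] by (intro mult_mono) auto
    then have "\<bar>f x * ((G x \<bullet> i) * (x \<bullet> i))\<bar> \<le> \<bar>f x\<bar> * (norm (G x) * R)"
      unfolding abs_mult[of "f x"] by (intro mult_left_mono) auto
    moreover have "2 * (\<bar>f x\<bar> * (norm (G x) * R)) \<le> \<bar>f x\<bar>\<^sup>2 / 2 + 2 * (norm (G x) * R)\<^sup>2"
      using zero_le_power2[of "\<bar>f x\<bar> - 2 * (norm (G x) * R)"]
      by (simp add: power2_diff power_mult_distrib algebra_simps)
    moreover have "?q x = (f x)\<^sup>2 + 2 * (f x * ((G x \<bullet> i) * (x \<bullet> i)))"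
      using i by (simp add: inner_same_Basis power2_eq_square algebra_simps)
    ultimately show ?thesis
      by (simp add: power_mult_distrib algebra_simps)
  qed
  then have "(LINT x|lebesgue_on \<Omega>. (norm (f x))\<^sup>2)
      \<le> (LINT x|lebesgue_on \<Omega>. ?q x + (norm (f x))\<^sup>2 / 2 + 2 * R\<^sup>2 * (norm (G x))\<^sup>2)"
    using f2 G2 q_on by (intro integral_mono) (auto simp: space_restrict_space)
  also have "\<dots> = (LINT x|lebesgue_on \<Omega>. (norm (f x))\<^sup>2) / 2 + 2 * R\<^sup>2 * (LINT x|lebesgue_on \<Omega>. (norm (G x))\<^sup>2)"
    using f2 G2 q_on q0 by simp
  finally have "(LINT x|lebesgue_on \<Omega>. (norm (f x))\<^sup>2) \<le> (2 * R)\<^sup>2 * (LINT x|lebesgue_on \<Omega>. (norm (G x))\<^sup>2)"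
    by (simp add: power_mult_distrib)
  then have "l2_norm \<Omega> f \<le> sqrt ((2 * R)\<^sup>2 * (LINT x|lebesgue_on \<Omega>. (norm (G x))\<^sup>2))"
    unfolding l2_norm_def by (rule real_sqrt_le_mono)
  then show ?thesis
    using that by (simp add: l2_norm_def real_sqrt_mult)
qed

end

text \<open>Pointwise existence of gradients does not by itself provide a measurable choice; limits
  of difference quotients of the continuous \<open>f\<close> do.\<close>

lemma lipschitz_gradientI:
  fixes f :: "'a::euclidean_space \<Rightarrow> real"
  assumes "open \<Omega>" "\<Omega> \<subseteq> cball 0 R" and lip: "L-lipschitz_on UNIV f" and supp: "\<And>x. x \<notin> \<Omega> \<Longrightarrow> f x = 0"
    and der: "AE x in lebesgue. \<exists>a. (f has_derivative (\<lambda>h. a \<bullet> h)) (at x)"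
  obtains G where "lipschitz_gradient \<Omega> R f G L"
proof -
  let ?q = "\<lambda>x u n. (f (x + (1 / real (Suc n)) *\<^sub>R u) - f x) * real (Suc n)"
  \<comment> \<open>Where a sequence diverges, \<open>lim\<close> is some unspecified value; this
    can happen only on a null set.\<close>
  define G where "G x = (\<Sum>i\<in>Basis. lim (?q x i) *\<^sub>R i)" for x
  have [measurable]: "f \<in> borel_measurable borel"
    by (rule borel_measurable_continuous_onI[OF lipschitz_on_continuous_on[OF lip]])
  have G: "G x = a" if "(f has_derivative (\<lambda>h. a \<bullet> h)) (at x)" for x a
  proof -
    have "lim (?q x i) = a \<bullet> i" for i
      using has_derivative_difference_quotient[OF that] by (rule limI)
    then show ?thesis by (simp add: G_def euclidean_representation)
  qed
  \<comment> \<open>Differentiating in the direction \<open>a\<close> itself yields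
    \<open>\<bar>a\<bar>^2 \<le> L * \<bar>a\<bar>\<close>.\<close>
  have le: "norm a \<le> L" if "(f has_derivative (\<lambda>h. a \<bullet> h)) (at x)" for x a
  proof -
    have "(\<lambda>n. \<bar>?q x a n\<bar>) \<longlonglongrightarrow> \<bar>a \<bullet> a\<bar>"
      by (intro tendsto_rabs has_derivative_difference_quotient[OF that])
    moreover have "\<bar>?q x a n\<bar> \<le> L * norm a" for n
    proof -
      have "\<bar>f (x + (1 / real (Suc n)) *\<^sub>R a) - f x\<bar> \<le> L * (norm a / real (Suc n))"
        using lipschitz_onD[OF lip, of "x + (1 / real (Suc n)) *\<^sub>R a" x] by (simp add: dist_norm)
      then have "\<bar>f (x + (1 / real (Suc n)) *\<^sub>R a) - f x\<bar> * real (Suc n) \<le> L * norm a"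
        by (simp add: field_simps)
      then show ?thesis by (simp add: abs_mult)
    qed
    ultimately have "\<bar>a \<bullet> a\<bar> \<le> L * norm a"
      by (intro LIMSEQ_le_const2) auto
    then have "norm a * norm a \<le> L * norm a"
      by (simp add: power2_norm_eq_inner[symmetric] power2_eq_square)
    then show ?thesis
      using lipschitz_on_nonneg[OF lip] by (cases "a = 0") auto
  qed
  have "lipschitz_gradient \<Omega> R f G L"
  proof
    show "G \<in> borel_measurable lebesgue"
      unfolding G_def by (rule measurable_completion) measurable
    show "AE x in lebesgue. norm (G x) \<le> L"
      using der by eventually_elim (use G le in auto)
    show "AE x in lebesgue. (f has_derivative (\<lambda>h. G x \<bullet> h)) (at x)"
      using der by eventually_elim (use G in auto)
  qed (fact assms)+
  then show thesis by (rule that)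
qed

section \<open>Finite element functions\<close>

lemma triangulation_of_simplexD:
  fixes \<Omega> :: "'a::euclidean_space set"
  assumes "triangulation_of \<Omega> T" "e \<in> T"
  shows "closed e" "convex e"
proof -
  have "polytope e"
    using assms simplex_imp_polytope by (auto simp: triangulation_of_def)
  then show "closed e" "convex e"
    by (auto simp: polytope_imp_compact polytope_imp_convex compact_imp_closed)
qed

text \<open>On each segment the zero extension is Lipschitz on the finitely many closed pieces cut out
  by the elements and by the complement of the domain.\<close>

lemma zero_extension_lipschitz:
  fixes \<Omega> :: "'a::euclidean_space set"
  assumes T: "triangulation_of \<Omega> T" and "open \<Omega>" and fr: "\<And>x. x \<in> frontier \<Omega> \<Longrightarrow> v x = 0"
    and aff: "\<And>e x. e \<in> T \<Longrightarrow> x \<in> e \<Longrightarrow> v x = a e \<bullet> x + b e"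
  shows "(\<Sum>e\<in>T. norm (a e))-lipschitz_on UNIV (\<lambda>x. if x \<in> \<Omega> then v x else 0)"
    (is "?L-lipschitz_on UNIV ?f")
proof (rule lipschitz_onI)
  define f where "f = ?f"
  have "finite T" and cover: "\<Union>T = closure \<Omega>"
    using T by (auto simp: triangulation_of_def triangulation_def)
  \<comment> \<open>An element may touch the boundary of \<open>\<Omega>\<close>; there the zero
    extension and the affine formula are both 0.\<close>
  have f_e: "f x = a e \<bullet> x + b e" if "e \<in> T" "x \<in> e" for e x
  proof -
    have "x \<in> closure \<Omega>" using that cover by auto
    then have "f x = v x"
      using fr \<open>open \<Omega>\<close> by (auto simp: f_def frontier_def interior_open)
    then show ?thesis using aff that by simp
  qed
  show L0: "?L \<ge> 0" by (simp add: sum_nonneg)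
  fix x y :: 'a
  let ?p = "\<lambda>t. x + t *\<^sub>R (y - x)" and ?M = "?L * dist x y"
  let ?U = "\<lambda>S. {t. ?p t \<in> S}"
  \<comment> \<open>Parametrising the segment over \<open>{0..1}\<close> puts its length into the
    constant; the endpoints 0 and 1 then give the claim.\<close>
  have "?M-lipschitz_on {0..1} (\<lambda>t. f (?p t))"
  proof (rule lipschitz_on_closed_Union[where U = ?U and I = "insert (- \<Omega>) T"])
    show "finite (insert (- \<Omega>) T)" using \<open>finite T\<close> by simp
    show "0 \<le> ?M" using L0 by simp
    show "{0..1} \<subseteq> (\<Union>S\<in>insert (- \<Omega>) T. ?U S)"
      using cover closure_subset[of \<Omega>] by blast
  next
    fix S assume "S \<in> insert (- \<Omega>) T"
    then have "closed S"
      using triangulation_of_simplexD(1)[OF T] \<open>open \<Omega>\<close> by auto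
    moreover have "continuous_on UNIV ?p" by (intro continuous_intros)
    ultimately show "closed (?U S)"
      using closed_vimage[of S ?p] by (simp add: vimage_def)
  next
    fix S assume S: "S \<in> insert (- \<Omega>) T"
    show "?M-lipschitz_on (?U S) (\<lambda>t. f (?p t))"
    proof (rule lipschitz_onI)
      fix s t assume st: "s \<in> ?U S" "t \<in> ?U S"
      show "dist (f (?p s)) (f (?p t)) \<le> ?M * dist s t"
      proof (cases "S \<in> T")
        case True
        have "f (?p s) - f (?p t) = a S \<bullet> ((s - t) *\<^sub>R (y - x))"
          using f_e[OF True, of "?p s"] f_e[OF True, of "?p t"] st by (simp add: inner_simps algebra_simps)
        also have "\<bar>\<dots>\<bar> \<le> norm (a S) * norm ((s - t) *\<^sub>R (y - x))"
          by (rule Cauchy_Schwarz_ineq2)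
        also have "\<dots> \<le> ?L * norm ((s - t) *\<^sub>R (y - x))"
          using True \<open>finite T\<close> by (intro mult_right_mono member_le_sum) auto
        also have "\<dots> = ?M * dist s t"
          by (simp add: dist_norm norm_minus_commute)
        finally show ?thesis by (simp add: dist_real_def)
      next
        case False
        then have "?p s \<notin> \<Omega>" "?p t \<notin> \<Omega>" using S st by auto
        then show ?thesis using L0 by (simp add: f_def)
      qed
    qed (use L0 in simp)
  qed
  then show "dist (?f x) (?f y) \<le> ?L * dist x y"
    using lipschitz_onD[of ?M "{0..1}" "\<lambda>t. f (?p t)" 0 1] by (simp add: f_def)
qed

text \<open>The frontiers of finitely many convex elements form a null set. Elsewhere the function
  is affine near the point, inside an element, or zero near it, off the closure of
  \<open>\<Omega>\<close>.\<close>

lemma zero_extension_AE_differentiable: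
  fixes \<Omega> :: "'a::euclidean_space set"
  assumes T: "triangulation_of \<Omega> T" and "open \<Omega>" and fr: "\<And>x. x \<in> frontier \<Omega> \<Longrightarrow> v x = 0"
    and aff: "\<And>e x. e \<in> T \<Longrightarrow> x \<in> e \<Longrightarrow> v x = a e \<bullet> x + b e"
  shows "AE x in lebesgue. \<exists>c. ((\<lambda>x. if x \<in> \<Omega> then v x else 0) has_derivative (\<lambda>h. c \<bullet> h)) (at x)"
proof -
  let ?f = "\<lambda>x. if x \<in> \<Omega> then v x else 0"
  have "finite T" and cover: "\<Union>T = closure \<Omega>"
    using T by (auto simp: triangulation_of_def triangulation_def)
  have "negligible (\<Union>(frontier ` T))"
    using \<open>finite T\<close> triangulation_of_simplexD(2)[OF T]
    by (intro negligible_Union) (auto intro: negligible_convex_frontier)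
  then have "AE x in lebesgue. x \<notin> \<Union>(frontier ` T)"
    by (intro AE_not_in) (simp add: negligible_iff_null_sets)
  then show ?thesis
  proof eventually_elim
    case (elim x)
    show ?case
    proof (cases "x \<in> closure \<Omega>")
      case True
      then obtain e where e: "e \<in> T" "x \<in> e" using cover by auto
      then have x: "x \<in> interior e"
        using elim triangulation_of_simplexD(1)[OF T] by (auto simp: frontier_def)
      have "((\<lambda>x. a e \<bullet> x + b e) has_derivative (\<lambda>h. a e \<bullet> h)) (at x)"
        by (auto intro!: derivative_eq_intros)
      then have "(?f has_derivative (\<lambda>h. a e \<bullet> h)) (at x)"
      proof (rule has_derivative_transform_within_open[OF _ open_interior x])
        fix y assume "y \<in> interior e"
        then have y: "y \<in> e" using interior_subset by blast
        then have "y \<in> closure \<Omega>" using e cover by auto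
        then have "?f y = v y"
          using fr \<open>open \<Omega>\<close> by (auto simp: frontier_def interior_open)
        then show "a e \<bullet> y + b e = ?f y" using aff e y by simp
      qed
      then show ?thesis by blast
    next
      case False
      have "((\<lambda>_. 0) has_derivative (\<lambda>h. 0 \<bullet> h)) (at x)" by simp
      then have "(?f has_derivative (\<lambda>h. 0 \<bullet> h)) (at x)"
        by (rule has_derivative_transform_within_open[of _ _ _ _ "- closure \<Omega>"])
          (use False closure_subset[of \<Omega>] in auto)
      then show ?thesis by blast
    qed
  qed
qed

lemma fe_lipschitz_gradient:
  fixes \<Omega> :: "'a::euclidean_space set"
  assumes \<Omega>: "open \<Omega>" "\<Omega> \<subseteq> cball 0 R" and T: "triangulation_of \<Omega> T"
    and fr: "\<forall>x \<in> frontier \<Omega>. v x = 0" and aff: "\<forall>e \<in> T. \<exists>a b. \<forall>x \<in> e. v x = a \<bullet> x + b"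
  obtains G L where "lipschitz_gradient \<Omega> R (\<lambda>x. if x \<in> \<Omega> then v x else 0) G L"
proof -
  obtain a b where ab: "\<And>e x. e \<in> T \<Longrightarrow> x \<in> e \<Longrightarrow> v x = a e \<bullet> x + b e"
    using aff by metis
  show thesis
    by (rule lipschitz_gradientI[OF \<Omega> zero_extension_lipschitz[OF T \<Omega>(1) _ ab] _
          zero_extension_AE_differentiable[OF T \<Omega>(1) _ ab]]) (use fr that in auto)
qed

section \<open>The Poincare inequality on finite element spaces\<close>

lemma l2_norm_cong_AE:
  assumes "f \<in> L2 \<Omega>" "g \<in> L2 \<Omega>" and "AE x in lebesgue_on \<Omega>. f x = g x"
  shows "l2_norm \<Omega> f = l2_norm \<Omega> g"
proof -
  have "(LINT x|lebesgue_on \<Omega>. (norm (f x))\<^sup>2) = (LINT x|lebesgue_on \<Omega>. (norm (g x))\<^sup>2)"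
    using assms by (intro integral_cong_AE) (auto simp: L2_def elim: eventually_mono)
  then show ?thesis by (simp add: l2_norm_def)
qed

lemma wgrad_has_weak_gradient: "has_weak_gradient \<Omega> v g \<Longrightarrow> has_weak_gradient \<Omega> v (wgrad \<Omega> v)"
  unfolding wgrad_def by (rule someI[where P = "has_weak_gradient \<Omega> v"])

lemma wgrad_L2: "v \<in> H1 \<Omega> \<Longrightarrow> wgrad \<Omega> v \<in> L2 \<Omega>"
  unfolding H1_def by (blast dest: wgrad_has_weak_gradient has_weak_gradient_def[THEN iffD1])

text \<open>The Lipschitz constant of the zero extension depends on \<open>v\<close> and the mesh,
  but does not enter the bound: only the radius \<open>R\<close> of the enclosing ball does.\<close>

lemma fe_space_Poincare:
  fixes \<Omega> :: "'a::euclidean_space set"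
  assumes \<Omega>: "open \<Omega>" "\<Omega> \<subseteq> cball 0 R" "R > 0" and T: "triangulation_of \<Omega> T" and v: "v \<in> fe_space \<Omega> T"
  shows "l2_norm \<Omega> v \<le> 2 * R * l2_norm \<Omega> (wgrad \<Omega> v)"
proof -
  have "bounded \<Omega>" using \<Omega> bounded_cball bounded_subset by blast
  let ?f = "\<lambda>x. if x \<in> \<Omega> then v x else 0"
  obtain G L where "lipschitz_gradient \<Omega> R ?f G L"
    using fe_lipschitz_gradient[OF \<Omega>(1,2) T] v unfolding fe_space_def by blast
  then interpret lipschitz_gradient \<Omega> R ?f G L .
  have G: "has_weak_gradient \<Omega> v G"
    by (rule has_weak_gradient) simp
  have "l2_norm \<Omega> v = l2_norm \<Omega> ?f"
    unfolding l2_norm_def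
    by (intro arg_cong[where f = sqrt] Bochner_Integration.integral_cong) (auto simp: space_restrict_space)
  also have "\<dots> \<le> 2 * R * l2_norm \<Omega> G"
    by (rule Poincare[OF \<open>R > 0\<close>])
  also have "l2_norm \<Omega> G = l2_norm \<Omega> (wgrad \<Omega> v)"
    using G_L2 wgrad_L2[of v \<Omega>] v
      weak_gradient_unique[OF \<Omega>(1) \<open>bounded \<Omega>\<close> G wgrad_has_weak_gradient[OF G]]
    by (intro l2_norm_cong_AE) (auto simp: fe_space_def)
  finally show ?thesis .
qed

section \<open>Linearity of weak gradients and of the finite element space\<close>

text \<open>Provides the integrability that lets the defining identity of weak gradients split over
  differences.\<close>

lemma test_function_partial_L2:
  assumes \<phi>: "test_function \<Omega> \<phi>" and i: "i \<in> Basis" and \<Omega>: "\<Omega> \<in> sets lebesgue"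
  shows "(\<lambda>x. frechet_derivative \<phi> (at x) i) \<in> L2 \<Omega>"
proof -
  obtain K where K: "compact K" "\<And>x. x \<notin> K \<Longrightarrow> \<phi> x = 0"
    using \<phi> unfolding test_function_def by blast
  have "frechet_derivative \<phi> (at x) i = 0" if "x \<notin> K" for x
  proof -
    have "((\<lambda>_. 0) has_derivative (\<lambda>_. 0)) (at x)" by simp
    then have "(\<phi> has_derivative (\<lambda>_. 0)) (at x)"
      by (rule has_derivative_transform_within_open[of _ _ _ _ "- K"])
        (use K that in \<open>auto simp: compact_imp_closed\<close>)
    then show ?thesis by (simp add: frechet_derivative_at[symmetric])
  qed
  moreover have "Ck 1 \<phi>" using \<phi> by (simp add: test_function_def)
  then have "continuous_on UNIV (\<lambda>x. frechet_derivative \<phi> (at x) i)"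
    using i by simp
  ultimately show ?thesis
    using L2_continuous_compact_support K(1) \<Omega> by blast
qed

lemma has_weak_gradient_diff:
  assumes \<Omega>: "\<Omega> \<in> sets lebesgue" and u: "u \<in> L2 \<Omega>" "has_weak_gradient \<Omega> u g"
    and v: "v \<in> L2 \<Omega>" "has_weak_gradient \<Omega> v h"
  shows "has_weak_gradient \<Omega> (\<lambda>x. u x - v x) (\<lambda>x. g x - h x)"
  unfolding has_weak_gradient_def
proof (intro conjI allI impI ballI)
  have gh: "g \<in> L2 \<Omega>" "h \<in> L2 \<Omega>" using u v by (auto simp: has_weak_gradient_def)
  then show "(\<lambda>x. g x - h x) \<in> L2 \<Omega>" by (rule L2_diff)
  fix \<phi> and i :: 'a assume \<phi>: "test_function \<Omega> \<phi>" and i: "i \<in> Basis"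
  let ?D = "\<lambda>x. frechet_derivative \<phi> (at x) i"
  have "integrable (lebesgue_on \<Omega>) (\<lambda>x. w x * ?D x)" if "w \<in> L2 \<Omega>" for w
    using L2_integrable_inner[OF that test_function_partial_L2[OF \<phi> i \<Omega>]] by simp
  moreover have "integrable (lebesgue_on \<Omega>) (\<lambda>x. (k x \<bullet> i) * \<phi> x)" if "k \<in> L2 \<Omega>" for k
    using L2_integrable_inner[OF L2_inner_component[OF that i] test_function_L2[OF \<phi> \<Omega>]] by simp
  ultimately show "(LINT x | lebesgue_on \<Omega>. (u x - v x) * ?D x)
      = - (LINT x | lebesgue_on \<Omega>. ((g x - h x) \<bullet> i) * \<phi> x)"
    using u v gh \<phi> i by (simp add: has_weak_gradient_def inner_diff_left left_diff_distrib)
qed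

text \<open>The representatives picked by \<open>wgrad\<close> need not be additive; uniqueness of
  weak gradients restores additivity almost everywhere.\<close>

lemma wgrad_diff:
  assumes \<Omega>: "open \<Omega>" "bounded \<Omega>" and u: "u \<in> H1 \<Omega>" and v: "v \<in> H1 \<Omega>"
  shows "(\<lambda>x. u x - v x) \<in> H1 \<Omega>"
    and "AE x in lebesgue_on \<Omega>. wgrad \<Omega> (\<lambda>x. u x - v x) x = wgrad \<Omega> u x - wgrad \<Omega> v x"
proof -
  have "\<Omega> \<in> sets lebesgue" using \<Omega> by auto
  then have d: "has_weak_gradient \<Omega> (\<lambda>x. u x - v x) (\<lambda>x. wgrad \<Omega> u x - wgrad \<Omega> v x)"
    using u v by (intro has_weak_gradient_diff) (auto simp: H1_def intro: wgrad_has_weak_gradient)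
  then show "(\<lambda>x. u x - v x) \<in> H1 \<Omega>"
    using u v L2_diff by (auto simp: H1_def)
  show "AE x in lebesgue_on \<Omega>. wgrad \<Omega> (\<lambda>x. u x - v x) x = wgrad \<Omega> u x - wgrad \<Omega> v x"
    by (rule weak_gradient_unique[OF \<Omega> wgrad_has_weak_gradient[OF d] d])
qed

lemma fe_space_diff:
  assumes \<Omega>: "open \<Omega>" "bounded \<Omega>" and u: "u \<in> fe_space \<Omega> T" and v: "v \<in> fe_space \<Omega> T"
  shows "(\<lambda>x. u x - v x) \<in> fe_space \<Omega> T"
  unfolding fe_space_def
proof (intro CollectI conjI ballI)
  show "(\<lambda>x. u x - v x) \<in> H1 \<Omega>"
    by (rule wgrad_diff(1)[OF \<Omega>]) (use u v in \<open>simp_all add: fe_space_def\<close>)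
next
  fix x assume "x \<in> frontier \<Omega>"
  then show "u x - v x = 0" using u v by (simp add: fe_space_def)
next
  fix e assume e: "e \<in> T"
  obtain a b where ab: "\<And>x. x \<in> e \<Longrightarrow> u x = a \<bullet> x + b"
    using u e unfolding fe_space_def by blast
  obtain c d where cd: "\<And>x. x \<in> e \<Longrightarrow> v x = c \<bullet> x + d"
    using v e unfolding fe_space_def by blast
  have "u x - v x = (a - c) \<bullet> x + (b - d)" if "x \<in> e" for x
    using ab[OF that] cd[OF that] by (simp add: inner_diff_left)
  then show "\<exists>a b. \<forall>x\<in>e. u x - v x = a \<bullet> x + b" by blast
qed

lemma fe_space_L2: "v \<in> fe_space \<Omega> T \<Longrightarrow> v \<in> L2 \<Omega>"
  by (simp add: fe_space_def H1_def)

text \<open>The sources \<open>p\<close> and \<open>r\<close> range over \<open>L2 \<Omega>\<close>,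
  since coarse concentrations need not lie in the fine space: the meshes are not assumed to be
  nested.\<close>

lemma poisson_energy_bound:
  fixes \<Omega> :: "'a::euclidean_space set"
  assumes \<Omega>: "open \<Omega>" "\<Omega> \<subseteq> cball 0 R" "R > 0" and T: "triangulation_of \<Omega> T"
    and \<phi>: "\<phi> \<in> fe_space \<Omega> T" "\<psi> \<in> fe_space \<Omega> T"
    and pr: "\<And>i. i \<in> {1, 2} \<Longrightarrow> p i \<in> L2 \<Omega>" "\<And>i. i \<in> {1, 2} \<Longrightarrow> r i \<in> L2 \<Omega>"
    and eqs: "poisson_eq \<Omega> F (fe_space \<Omega> T) p \<phi>" "poisson_eq \<Omega> F (fe_space \<Omega> T) r \<psi>"
  shows "l2_norm \<Omega> (wgrad \<Omega> (\<lambda>x. \<phi> x - \<psi> x))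
    \<le> 2 * R * (\<Sum>i \<in> {1, 2}. l2_norm \<Omega> (\<lambda>x. p i x - r i x))"
proof -
  have bd: "bounded \<Omega>" using \<Omega> bounded_cball bounded_subset by blast
  define w where "w x = \<phi> x - \<psi> x" for x
  have w: "w \<in> fe_space \<Omega> T"
    unfolding w_def by (rule fe_space_diff[OF \<Omega>(1) bd \<phi>])
  have H1: "\<phi> \<in> H1 \<Omega>" "\<psi> \<in> H1 \<Omega>" "w \<in> H1 \<Omega>"
    using \<phi> w by (auto simp: fe_space_def)
  note L = wgrad_L2[OF H1(1)] wgrad_L2[OF H1(2)] wgrad_L2[OF H1(3)]
  let ?E = "l2_norm \<Omega> (wgrad \<Omega> w)" and ?S = "\<Sum>i \<in> {1, 2}. l2_norm \<Omega> (\<lambda>x. p i x - r i x)"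
  have ae: "AE x in lebesgue_on \<Omega>. wgrad \<Omega> w x = wgrad \<Omega> \<phi> x - wgrad \<Omega> \<psi> x"
    unfolding w_def by (rule wgrad_diff(2)[OF \<Omega>(1) bd H1(1,2)])
  have "?E\<^sup>2 = l2_inner \<Omega> (\<lambda>x. wgrad \<Omega> \<phi> x - wgrad \<Omega> \<psi> x) (wgrad \<Omega> w)"
    unfolding l2_norm_power2 l2_inner_def
    by (rule integral_cong_AE) (use ae L in \<open>auto simp: L2_def elim: eventually_mono\<close>)
  also have "\<dots> = l2_inner \<Omega> (wgrad \<Omega> \<phi>) (wgrad \<Omega> w) - l2_inner \<Omega> (wgrad \<Omega> \<psi>) (wgrad \<Omega> w)"
    by (rule l2_inner_diff_left[OF L])
  \<comment> \<open>Both equations are tested with the same \<open>w\<close>, so the terms with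
    \<open>F 3\<close> cancel.\<close>
  also have "\<dots> = (\<Sum>i \<in> {1, 2}. charge i * l2_inner \<Omega> (p i) w) - (\<Sum>i \<in> {1, 2}. charge i * l2_inner \<Omega> (r i) w)"
    using eqs w by (simp add: poisson_eq_def)
  also have "\<dots> = (\<Sum>i \<in> {1, 2}. charge i * l2_inner \<Omega> (\<lambda>x. p i x - r i x) w)"
    using pr fe_space_L2[OF w]
    by (simp add: sum_subtractf[symmetric] l2_inner_diff_left right_diff_distrib del: sum.insert)
  also have "\<dots> \<le> (\<Sum>i \<in> {1, 2}. l2_norm \<Omega> (\<lambda>x. p i x - r i x) * l2_norm \<Omega> w)"
  proof (rule sum_mono)
    fix i :: nat assume i: "i \<in> {1, 2}"
    \<comment> \<open>The charges are 1 and -1, so they disappear under the absolute value.\<close>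
    have "charge i * l2_inner \<Omega> (\<lambda>x. p i x - r i x) w \<le> \<bar>l2_inner \<Omega> (\<lambda>x. p i x - r i x) w\<bar>"
      by (auto simp: charge_def abs_ge_self abs_ge_minus_self)
    also have "\<dots> \<le> l2_norm \<Omega> (\<lambda>x. p i x - r i x) * l2_norm \<Omega> w"
      by (rule l2_Cauchy_Schwarz[OF L2_diff[OF pr(1)[OF i] pr(2)[OF i]] fe_space_L2[OF w]])
    finally show "charge i * l2_inner \<Omega> (\<lambda>x. p i x - r i x) w \<le> \<dots>" .
  qed
  also have "\<dots> = ?S * l2_norm \<Omega> w"
    by (simp only: sum_distrib_right)
  also have "\<dots> \<le> ?S * (2 * R * ?E)"
    by (intro mult_left_mono fe_space_Poincare[OF \<Omega> T w] sum_nonneg l2_norm_nonneg)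
  finally have le: "?E * ?E \<le> (2 * R * ?S) * ?E"
    by (simp only: power2_eq_square mult.assoc mult.left_commute[of ?S])
  have nonneg: "0 \<le> 2 * R * ?S"
    using \<Omega>(3) by (intro mult_nonneg_nonneg sum_nonneg l2_norm_nonneg) auto
  \<comment> \<open>One factor \<open>?E\<close> is cancelled when it is positive; otherwise the
    nonnegative right-hand side suffices.\<close>
  have "?E \<le> 2 * R * ?S"
  proof (cases "?E > 0")
    case True
    with le show ?thesis by (rule mult_right_le_imp_le)
  next
    case False
    with nonneg show ?thesis by linarith
  qed
  moreover have "w = (\<lambda>x. \<phi> x - \<psi> x)" by (simp add: w_def fun_eq_iff)
  ultimately show ?thesis by simp
qed

theorem theorem3p1:
  fixes \<Omega> :: "'a::euclidean_space set"
    and F :: "nat \<Rightarrow> 'a \<Rightarrow> real"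
    and I :: "real set"
    and \<Gamma> :: "real \<Rightarrow> 'a set set"
  assumes "DIM('a) = 2 \<or> DIM('a) = 3"
    and "bounded_lipschitz_domain \<Omega>"
    and "F 1 \<in> L2 \<Omega>" and "F 2 \<in> L2 \<Omega>" and "F 3 \<in> L2 \<Omega>"
    and "quasi_uniform_family \<Omega> I \<Gamma>"
    and "uniquely_solvable \<Omega> (pnp_solution \<Omega> F (H10 \<Omega>))"
    and "\<And>h. h \<in> I \<Longrightarrow> uniquely_solvable \<Omega> (pnp_solution \<Omega> F (fe_space \<Omega> (\<Gamma> h)))"
    and "\<And>h H p\<^sub>H \<phi>\<^sub>H. h \<in> I \<Longrightarrow> H \<in> I \<Longrightarrow> pnp_solution \<Omega> F (fe_space \<Omega> (\<Gamma> H)) p\<^sub>H \<phi>\<^sub>H \<Longrightarrow>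
           uniquely_solvable \<Omega> (two_grid_solution \<Omega> F (fe_space \<Omega> (\<Gamma> h)) p\<^sub>H)"
  shows "\<exists>C > 0. \<forall>h \<in> I. \<forall>H \<in> I. \<forall>p\<^sub>h \<phi>\<^sub>h p\<^sub>H \<phi>\<^sub>H p\<^sub>s \<phi>\<^sub>s.
           pnp_solution \<Omega> F (fe_space \<Omega> (\<Gamma> h)) p\<^sub>h \<phi>\<^sub>h \<longrightarrow>
           pnp_solution \<Omega> F (fe_space \<Omega> (\<Gamma> H)) p\<^sub>H \<phi>\<^sub>H \<longrightarrow>
           two_grid_solution \<Omega> F (fe_space \<Omega> (\<Gamma> h)) p\<^sub>H p\<^sub>s \<phi>\<^sub>s \<longrightarrow>
           l2_norm \<Omega> (wgrad \<Omega> (\<lambda>x. \<phi>\<^sub>h x - \<phi>\<^sub>s x))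
             \<le> C * (\<Sum>i \<in> {1, 2}. l2_norm \<Omega> (\<lambda>x. p\<^sub>h i x - p\<^sub>H i x))"
proof -
  have op: "open \<Omega>" and "bounded \<Omega>"
    using assms(2) by (auto simp: bounded_lipschitz_domain_def)
  then obtain R where R: "R > 0" "\<forall>x\<in>\<Omega>. norm x \<le> R"
    unfolding bounded_pos by blast
  then have sub: "\<Omega> \<subseteq> cball 0 R" by auto
  show ?thesis
  \<comment> \<open>\<open>R\<close> is the radius of a ball about the origin containing
    \<open>\<Omega>\<close>, so the constant is fixed before \<open>h\<close> and \<open>H\<close>
    are chosen.\<close>
  proof (intro exI[of _ "2 * R"] conjI ballI allI impI)
    fix h H p\<^sub>h \<phi>\<^sub>h p\<^sub>H \<phi>\<^sub>H p\<^sub>s \<phi>\<^sub>s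
    assume "h \<in> I" "H \<in> I"
      and fine: "pnp_solution \<Omega> F (fe_space \<Omega> (\<Gamma> h)) p\<^sub>h \<phi>\<^sub>h"
      and coarse: "pnp_solution \<Omega> F (fe_space \<Omega> (\<Gamma> H)) p\<^sub>H \<phi>\<^sub>H"
      and two: "two_grid_solution \<Omega> F (fe_space \<Omega> (\<Gamma> h)) p\<^sub>H p\<^sub>s \<phi>\<^sub>s"
    have T: "triangulation_of \<Omega> (\<Gamma> h)"
      using assms(6) \<open>h \<in> I\<close> by (simp add: quasi_uniform_family_def)
    \<comment> \<open>The fine potential and the two-grid potential solve Poisson equations over the
      same fine space, with sources \<open>p\<^sub>h\<close> and \<open>p\<^sub>H\<close>.\<close>
    show "l2_norm \<Omega> (wgrad \<Omega> (\<lambda>x. \<phi>\<^sub>h x - \<phi>\<^sub>s x))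
        \<le> 2 * R * (\<Sum>i \<in> {1, 2}. l2_norm \<Omega> (\<lambda>x. p\<^sub>h i x - p\<^sub>H i x))"
      by (rule poisson_energy_bound[OF op sub R(1) T])
        (use fine coarse two in \<open>auto simp: pnp_solution_def two_grid_solution_def intro: fe_space_L2\<close>)
  qed (use R in simp)
qed

end
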